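(* Let $K$ be a field of characteristic zero, $A$ a commutative associative unital $K$-algebra and $(G,\rho)$ a Lie--Rinehart algebra over $A$. Then the formulas \[ [x_1\wedge\cdots\wedge x_p,\;y_1\wedge\cdots\wedge y_q]_{SN}=\sum_{i=1}^p\sum_{j=1}^q(-1)^{i+j}[x_i,y_j]\wedge\widehat X_i\wedge\widehat Y_j\qquad(p,q\ge1) \] and \[ [x_1\wedge\cdots\wedge x_p,\;a]_{SN}=\sum_{i=1}^p(-1)^{p-i}\rho(x_i)(a)\,\widehat X_i,\qquad [a,\;x_1\wedge\cdots\wedge x_p]_{SN}=\sum_{i=1}^p(-1)^{i}\rho(x_i)(a)\,\widehat X_i\qquad(p\ge1), \] where $x_1,\dots,x_p,y_1,\dots,y_q\in G$ and $a\in A$, descend to well-defined $K$-bilinear maps on $\bigwedge_A G$; that is, the right-hand sides, regarded as functions of the tuples $(x_1,\dots,x_p)\in G^p$, $(y_1,\dots,y_q)\in G^q$ and of $a\in A$, induce well-defined $K$-bilinear maps $\bigwedge_A^pG\times\bigwedge_A^qG\to\bigwedge_A^{p+q-1}G$, $\bigwedge_A^pG\times A\to\bigwedge_A^{p-1}G$ and $A\times\bigwedge_A^pG\to\bigwedge_A^{p-1}G$ respectively.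
   Context: A Lie--Rinehart algebra over $A$ is an $A$-module $G$ endowed with a $K$-Lie bracket $[\cdot,\cdot]$ and an $A$-linear map $\rho:G\to\operatorname{Der}_K(A)$ (the anchor) that is a morphism of $K$-Lie algebras, such that $[x,ay]=a[x,y]+\rho(x)(a)y$ for all $a\in A$, $x,y\in G$. The exterior algebra over $A$ is $\bigwedge_AG=\bigoplus_{p\ge0}\bigwedge_A^pG$, with $\bigwedge_A^0G=A$ and $\bigwedge_A^1G=G$. Notation: $\widehat X_i=x_1\wedge\cdots\wedge x_{i-1}\wedge x_{i+1}\wedge\cdots\wedge x_p\in\bigwedge_A^{p-1}G$ (the factor $x_i$ is omitted, and $\widehat X_1=1$ if $p=1$); similarly $\widehat Y_j$ is $y_1\wedge\cdots\wedge y_q$ with $y_j$ omitted. The space $\bigwedge_A^pG$ is the quotient of the free $K$-module on $G^p$ by the relations expressing $K$-multilinearity, $A$-balancing $(\dots,ax_k,\dots,x_l,\dots)\sim(\dots,x_k,\dots,ax_l,\dots)$, and alternation (vanishing when two entries coincide). *)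

theory Defs
  imports Complex_Main "HOL-Library.Poly_Mapping" "HOL-Library.FuncSet" "HOL-Library.Set_Algebras"
    "HOL-Library.Product_Plus"
begin

section \<open>Lie--Rinehart algebras\<close>

text \<open>The sort \<open>{comm_ring, comm_monoid_mult}\<close> is that of commutative unital rings; unlike
  \<open>comm_ring_1\<close> it does not exclude the zero ring.\<close>

locale comm_algebra = vector_space scK
  for scK :: "'k::field \<Rightarrow> 'a::{comm_ring, comm_monoid_mult} \<Rightarrow> 'a" +
  assumes scale_mult_left: "scK c (a * b) = scK c a * b"

definition Der :: "('k::field \<Rightarrow> 'a::{comm_ring, comm_monoid_mult} \<Rightarrow> 'a) \<Rightarrow> ('a \<Rightarrow> 'a) set" where
  "Der scK = {D. Vector_Spaces.linear scK scK D \<and> (\<forall>a b. D (a * b) = a * D b + D a * b)}"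

locale lie_algebra = vector_space sc
  for sc :: "'k::field \<Rightarrow> 'g::ab_group_add \<Rightarrow> 'g" +
  fixes br :: "'g \<Rightarrow> 'g \<Rightarrow> 'g"
  assumes bracket_linear_left: "Vector_Spaces.linear sc sc (\<lambda>x. br x y)"
    and bracket_linear_right: "Vector_Spaces.linear sc sc (br x)"
    and bracket_self: "br x x = 0"
    and jacobi: "br x (br y z) + br y (br z x) + br z (br x y) = 0"

text \<open>\<open>scA\<close> is the action of \<open>A\<close> on \<open>G\<close>. Its module axioms are spelled out because the locale
  \<^locale>\<open>module\<close> requires \<^class>\<open>comm_ring_1\<close>. The field \<open>K\<close> acts on \<open>G\<close> by restriction of
  scalars along \<open>K \<rightarrow> A\<close>, \<open>c \<mapsto> c 1\<close>.\<close>

locale lie_rinehart =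
  A: comm_algebra scK + G: lie_algebra "\<lambda>c x. scA (scK c 1) x" br
  for scK :: "'k::field_char_0 \<Rightarrow> 'a::{comm_ring, comm_monoid_mult} \<Rightarrow> 'a"
    and scA :: "'a \<Rightarrow> 'g::ab_group_add \<Rightarrow> 'g"
    and br :: "'g \<Rightarrow> 'g \<Rightarrow> 'g" +
  fixes rho :: "'g \<Rightarrow> 'a \<Rightarrow> 'a"
  assumes scA_right_distrib: "scA a (x + y) = scA a x + scA a y"
    and scA_left_distrib: "scA (a + b) x = scA a x + scA b x"
    and scA_scA: "scA a (scA b x) = scA (a * b) x"
    and scA_one: "scA 1 x = x"
    and rho_Der: "rho x \<in> Der scK"
    and rho_add: "rho (x + y) a = rho x a + rho y a"
    and rho_scale: "rho (scA b x) a = b * rho x a"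
    and rho_bracket: "rho (br x y) a = rho x (rho y a) - rho y (rho x a)"
    and bracket_leibniz: "br x (scA a y) = scA a (br x y) + scA (rho x a) y"

section \<open>Exterior powers\<close>

text \<open>The free \<open>K\<close>-module on tuples is the type \<^typ>\<open>'g list \<Rightarrow>\<^sub>0 'k\<close>.\<close>

definition free_scale :: "'k::field \<Rightarrow> ('t \<Rightarrow>\<^sub>0 'k) \<Rightarrow> ('t \<Rightarrow>\<^sub>0 'k)" where
  "free_scale c = Poly_Mapping.map ((*) c)"

lemma lookup_free_scale [simp]:
  "Poly_Mapping.lookup (free_scale c u) t = c * Poly_Mapping.lookup u t"
  by (simp add: free_scale_def Poly_Mapping.map.rep_eq when_def)

interpretation free: vector_space free_scale
  by unfold_locales (auto intro!: poly_mapping_eqI simp: lookup_add algebra_simps)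

definition ext_relators ::
  "('k::field \<Rightarrow> 'a::{comm_ring, comm_monoid_mult} \<Rightarrow> 'a) \<Rightarrow> ('a \<Rightarrow> 'g::ab_group_add \<Rightarrow> 'g)
    \<Rightarrow> nat \<Rightarrow> ('g list \<Rightarrow>\<^sub>0 'k) set" where
  "ext_relators scK scA p =
     {Poly_Mapping.single (xs[k := x + y]) 1
        - Poly_Mapping.single (xs[k := x]) 1 - Poly_Mapping.single (xs[k := y]) 1
      | xs k x y. length xs = p \<and> k < p}
   \<union> {Poly_Mapping.single (xs[k := scA (scK c 1) x]) 1 - Poly_Mapping.single (xs[k := x]) c
      | xs k c x. length xs = p \<and> k < p}
   \<union> {Poly_Mapping.single (xs[k := scA a (xs ! k)]) 1
        - Poly_Mapping.single (xs[l := scA a (xs ! l)]) 1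
      | xs k l a. length xs = p \<and> k < p \<and> l < p \<and> k \<noteq> l}
   \<union> {Poly_Mapping.single xs 1
      | xs k l. length xs = p \<and> k < p \<and> l < p \<and> k \<noteq> l \<and> xs ! k = xs ! l}"

text \<open>To have all exterior powers in one type, including \<open>\<And>\<^sup>0 G = A\<close>, representatives are pairs in
  \<open>A \<times> K[tuples]\<close>: in degree \<open>0\<close> only the first component is used and nothing is divided out,
  in degree \<open>p \<ge> 1\<close> only the second one is used.\<close>

definition ext_reps :: "nat \<Rightarrow> ('a::zero \<times> ('g list \<Rightarrow>\<^sub>0 'k::zero)) set" where
  "ext_reps p = (if p = 0 then UNIV \<times> {0}
     else {0} \<times> {u. \<forall>xs \<in> Poly_Mapping.keys u. length xs = p})"

definition ext_rel ::
  "('k::field \<Rightarrow> 'a::{comm_ring, comm_monoid_mult} \<Rightarrow> 'a) \<Rightarrow> ('a \<Rightarrow> 'g::ab_group_add \<Rightarrow> 'g)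
    \<Rightarrow> nat \<Rightarrow> ('a \<times> ('g list \<Rightarrow>\<^sub>0 'k)) set" where
  "ext_rel scK scA p = (if p = 0 then {0} else {0} \<times> free.span (ext_relators scK scA p))"

definition rep_scale ::
  "('k::field \<Rightarrow> 'a \<Rightarrow> 'a) \<Rightarrow> 'k \<Rightarrow> 'a \<times> ('g list \<Rightarrow>\<^sub>0 'k) \<Rightarrow> 'a \<times> ('g list \<Rightarrow>\<^sub>0 'k)" where
  "rep_scale scK c w = (scK c (fst w), free_scale c (snd w))"

definition ext_class ::
  "('k::field \<Rightarrow> 'a::{comm_ring, comm_monoid_mult} \<Rightarrow> 'a) \<Rightarrow> ('a \<Rightarrow> 'g::ab_group_add \<Rightarrow> 'g)
    \<Rightarrow> nat \<Rightarrow> 'a \<times> ('g list \<Rightarrow>\<^sub>0 'k) \<Rightarrow> ('a \<times> ('g list \<Rightarrow>\<^sub>0 'k)) set" where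
  "ext_class scK scA p w = w +o ext_rel scK scA p"

definition ext_power ::
  "('k::field \<Rightarrow> 'a::{comm_ring, comm_monoid_mult} \<Rightarrow> 'a) \<Rightarrow> ('a \<Rightarrow> 'g::ab_group_add \<Rightarrow> 'g)
    \<Rightarrow> nat \<Rightarrow> ('a \<times> ('g list \<Rightarrow>\<^sub>0 'k)) set set" where
  "ext_power scK scA p = ext_class scK scA p ` ext_reps p"

text \<open>Addition of cosets is the elementwise sum \<open>X + Y\<close> of sets. For scalar multiplication the
  submodule is added back, since \<open>0 X\<close> has to be the zero coset rather than \<open>{0}\<close>.\<close>

definition ext_scale ::
  "('k::field \<Rightarrow> 'a::{comm_ring, comm_monoid_mult} \<Rightarrow> 'a) \<Rightarrow> ('a \<Rightarrow> 'g::ab_group_add \<Rightarrow> 'g)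
    \<Rightarrow> nat \<Rightarrow> 'k \<Rightarrow> ('a \<times> ('g list \<Rightarrow>\<^sub>0 'k)) set \<Rightarrow> ('a \<times> ('g list \<Rightarrow>\<^sub>0 'k)) set" where
  "ext_scale scK scA p c X = rep_scale scK c ` X + ext_rel scK scA p"

definition ext_bilinear ::
  "('k::field \<Rightarrow> 'a::{comm_ring, comm_monoid_mult} \<Rightarrow> 'a) \<Rightarrow> ('a \<Rightarrow> 'g::ab_group_add \<Rightarrow> 'g)
    \<Rightarrow> nat \<Rightarrow> nat \<Rightarrow> nat
    \<Rightarrow> (('a \<times> ('g list \<Rightarrow>\<^sub>0 'k)) set \<times> ('a \<times> ('g list \<Rightarrow>\<^sub>0 'k)) set
         \<Rightarrow> ('a \<times> ('g list \<Rightarrow>\<^sub>0 'k)) set) set" where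
  "ext_bilinear scK scA p q r =
    {B \<in> ext_power scK scA p \<times> ext_power scK scA q \<rightarrow>\<^sub>E ext_power scK scA r.
      (\<forall>X \<in> ext_power scK scA p. \<forall>X' \<in> ext_power scK scA p. \<forall>Y \<in> ext_power scK scA q.
         B (X + X', Y) = B (X, Y) + B (X', Y)) \<and>
      (\<forall>X \<in> ext_power scK scA p. \<forall>Y \<in> ext_power scK scA q. \<forall>Y' \<in> ext_power scK scA q.
         B (X, Y + Y') = B (X, Y) + B (X, Y')) \<and>
      (\<forall>c. \<forall>X \<in> ext_power scK scA p. \<forall>Y \<in> ext_power scK scA q.
         B (ext_scale scK scA p c X, Y) = ext_scale scK scA r c (B (X, Y)) \<and>
         B (X, ext_scale scK scA q c Y) = ext_scale scK scA r c (B (X, Y)))}"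

section \<open>Right-hand sides of the Schouten--Nijenhuis bracket\<close>

definition scalar :: "'a \<Rightarrow> 'a \<times> ('g list \<Rightarrow>\<^sub>0 'k::zero)" where
  "scalar a = (a, 0)"

definition tuple :: "'g list \<Rightarrow> 'a::zero \<times> ('g list \<Rightarrow>\<^sub>0 'k::zero_neq_one)" where
  "tuple xs = (0, Poly_Mapping.single xs 1)"

text \<open>A representative of \<open>b (x\<^sub>1 \<and> \<dots> \<and> x\<^sub>p)\<close>: the element \<open>b\<close> of \<open>A\<close> if \<open>p = 0\<close> (the empty
  wedge product is \<open>1\<close>), and \<open>(b x\<^sub>1) \<and> x\<^sub>2 \<and> \<dots> \<and> x\<^sub>p\<close> otherwise.\<close>

definition scaled_tuple ::
  "('a::zero \<Rightarrow> 'g \<Rightarrow> 'g) \<Rightarrow> 'a \<Rightarrow> 'g list \<Rightarrow> 'a \<times> ('g list \<Rightarrow>\<^sub>0 'k::zero_neq_one)" where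
  "scaled_tuple scA b xs = (case xs of [] \<Rightarrow> scalar b | x # zs \<Rightarrow> tuple (scA b x # zs))"

text \<open>The right-hand sides are formed at the level of representatives; \<^const>\<open>ext_class\<close> maps them to
  the exterior power. Positions in tuples are counted from \<open>1\<close> here, as in the usual formulas.\<close>

definition entry :: "'g list \<Rightarrow> nat \<Rightarrow> 'g" where
  "entry xs i = xs ! (i - 1)"

definition omit :: "nat \<Rightarrow> 'g list \<Rightarrow> 'g list" where
  "omit i xs = take (i - 1) xs @ drop i xs"

definition SN_rhs ::
  "('k::field \<Rightarrow> 'a::{comm_ring, comm_monoid_mult} \<Rightarrow> 'a) \<Rightarrow> ('g \<Rightarrow> 'g \<Rightarrow> 'g)
    \<Rightarrow> 'g list \<Rightarrow> 'g list \<Rightarrow> 'a \<times> ('g list \<Rightarrow>\<^sub>0 'k)" where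
  "SN_rhs scK br xs ys =
    (\<Sum>i = 1..length xs. \<Sum>j = 1..length ys.
       rep_scale scK ((- 1) ^ (i + j)) (tuple (br (entry xs i) (entry ys j) # omit i xs @ omit j ys)))"

definition SN_rhs_right ::
  "('k::field \<Rightarrow> 'a::{comm_ring, comm_monoid_mult} \<Rightarrow> 'a) \<Rightarrow> ('a \<Rightarrow> 'g \<Rightarrow> 'g)
    \<Rightarrow> ('g \<Rightarrow> 'a \<Rightarrow> 'a) \<Rightarrow> 'g list \<Rightarrow> 'a \<Rightarrow> 'a \<times> ('g list \<Rightarrow>\<^sub>0 'k)" where
  "SN_rhs_right scK scA rho xs a =
    (\<Sum>i = 1..length xs.
       rep_scale scK ((- 1) ^ (length xs - i)) (scaled_tuple scA (rho (entry xs i) a) (omit i xs)))"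

definition SN_rhs_left ::
  "('k::field \<Rightarrow> 'a::{comm_ring, comm_monoid_mult} \<Rightarrow> 'a) \<Rightarrow> ('a \<Rightarrow> 'g \<Rightarrow> 'g)
    \<Rightarrow> ('g \<Rightarrow> 'a \<Rightarrow> 'a) \<Rightarrow> 'a \<Rightarrow> 'g list \<Rightarrow> 'a \<times> ('g list \<Rightarrow>\<^sub>0 'k)" where
  "SN_rhs_left scK scA rho a xs =
    (\<Sum>i = 1..length xs.
       rep_scale scK ((- 1) ^ i) (scaled_tuple scA (rho (entry xs i) a) (omit i xs)))"

end

theory Submission
  imports Defs
begin

text \<open>By linear extension in each argument it suffices that the right-hand sides respect the relations.
  Since the exterior powers are quotients of vector spaces over a field, this may be tested after
  applying a linear functional that kills the relations of the target, that is, an alternating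
  multilinear form \<open>t\<close> that is balanced over \<open>A\<close>. The right-hand sides then become sums
  \<open>\<Sum>\<^sub>i (-1)\<^sup>i E(x\<^sub>i, omit i xs)\<close>. Such a sum is again alternating and balanced, provided that the
  failure of \<open>E\<close> to be balanced between its two arguments is a form \<open>N\<close> for which
  \<open>(-1)\<^sup>i N(x\<^sub>i, omit i xs)\<close> does not depend on \<open>i\<close>. For \<open>E(x, zs) = t([x, y] \<and> zs)\<close> the failure comes
  from the anchor term of the Leibniz rule, and moving \<open>x\<^sub>i\<close> back to its place absorbs the sign.\<close>

section \<open>Alternating forms\<close>

text \<open>The clauses answer one by one to the families in \<open>ext_relators\<close>: for
  \<open>n > 0\<close> these are the functions that linear functionals on the \<open>n\<close>-th
  exterior power induce on tuples, with balancing over \<open>A\<close> included despite the name.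
  Only lists of length \<open>n\<close> are constrained, so for \<open>n = 0\<close> every function
  qualifies.\<close>

definition alternating_form ::
  "('k::field \<Rightarrow> 'a::{comm_ring, comm_monoid_mult} \<Rightarrow> 'a) \<Rightarrow> ('a \<Rightarrow> 'g::ab_group_add \<Rightarrow> 'g)
    \<Rightarrow> nat \<Rightarrow> ('g list \<Rightarrow> 'k) \<Rightarrow> bool" where
  "alternating_form scK scA n t \<longleftrightarrow>
     (\<forall>xs k x y. length xs = n \<longrightarrow> k < n \<longrightarrow> t (xs[k := x + y]) = t (xs[k := x]) + t (xs[k := y])) \<and>
     (\<forall>xs k c x. length xs = n \<longrightarrow> k < n \<longrightarrow> t (xs[k := scA (scK c 1) x]) = c * t (xs[k := x])) \<and>
     (\<forall>xs k l a. length xs = n \<longrightarrow> k < n \<longrightarrow> l < n \<longrightarrow> k \<noteq> l \<longrightarrow>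
        t (xs[k := scA a (xs ! k)]) = t (xs[l := scA a (xs ! l)])) \<and>
     (\<forall>xs k l. length xs = n \<longrightarrow> k < n \<longrightarrow> l < n \<longrightarrow> k \<noteq> l \<longrightarrow> xs ! k = xs ! l \<longrightarrow> t xs = 0)"

lemma alternating_formI:
  assumes "\<And>xs k x y. length xs = n \<Longrightarrow> k < n \<Longrightarrow> t (xs[k := x + y]) = t (xs[k := x]) + t (xs[k := y])"
    and "\<And>xs k c x. length xs = n \<Longrightarrow> k < n \<Longrightarrow> t (xs[k := scA (scK c 1) x]) = c * t (xs[k := x])"
    and "\<And>xs k l a. length xs = n \<Longrightarrow> k < n \<Longrightarrow> l < n \<Longrightarrow> k \<noteq> l \<Longrightarrow>
        t (xs[k := scA a (xs ! k)]) = t (xs[l := scA a (xs ! l)])"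
    and "\<And>xs k l. length xs = n \<Longrightarrow> k < n \<Longrightarrow> l < n \<Longrightarrow> k \<noteq> l \<Longrightarrow> xs ! k = xs ! l \<Longrightarrow> t xs = 0"
  shows "alternating_form scK scA n t"
  using assms unfolding alternating_form_def by blast

lemma
  assumes "alternating_form scK scA n t" "length xs = n" "k < n"
  shows alternating_form_add: "t (xs[k := x + y]) = t (xs[k := x]) + t (xs[k := y])"
    and alternating_form_scale: "t (xs[k := scA (scK c 1) x]) = c * t (xs[k := x])"
    and alternating_form_balanced: "l < n \<Longrightarrow> t (xs[k := scA a (xs ! k)]) = t (xs[l := scA a (xs ! l)])"
    and alternating_form_eq: "l < n \<Longrightarrow> k \<noteq> l \<Longrightarrow> xs ! k = xs ! l \<Longrightarrow> t xs = 0"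
proof -
  note def = assms(1)[unfolded alternating_form_def]
  show "t (xs[k := x + y]) = t (xs[k := x]) + t (xs[k := y])"
    using def[THEN conjunct1] assms(2,3) by simp
  show "t (xs[k := scA (scK c 1) x]) = c * t (xs[k := x])"
    using def[THEN conjunct2, THEN conjunct1] assms(2,3) by simp
  show "t (xs[k := scA a (xs ! k)]) = t (xs[l := scA a (xs ! l)])" if "l < n"
    using def[THEN conjunct2, THEN conjunct2, THEN conjunct1] assms(2,3) that by (cases "k = l") (simp, blast)
  show "t xs = 0" if "l < n" "k \<noteq> l" "xs ! k = xs ! l"
    using def[THEN conjunct2, THEN conjunct2, THEN conjunct2] assms(2,3) that by blast
qed

lemma alternating_form_cong:
  fixes t :: "'g::ab_group_add list \<Rightarrow> 'k::field"
  assumes "alternating_form scK scA n t" and "\<And>xs. length xs = n \<Longrightarrow> t xs = t' xs"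
  shows "alternating_form scK scA n t'"
proof -
  have *: "t' (xs[k := x]) = t (xs[k := x])" "t' xs = t xs" if "length xs = n" for xs k x
    using assms(2) that by simp_all
  show ?thesis
  proof (rule alternating_formI)
    fix xs :: "'g list" and k l a
    assume "length xs = n" "k < n" "l < n" "k \<noteq> l"
    then show "t' (xs[k := scA a (xs ! k)]) = t' (xs[l := scA a (xs ! l)])"
      using alternating_form_balanced[OF assms(1), of xs k l a] by (simp add: *)
  next
    fix xs :: "'g list" and k l
    assume "length xs = n" "k < n" "l < n" "k \<noteq> l" "xs ! k = xs ! l"
    then show "t' xs = 0"
      using alternating_form_eq[OF assms(1), of xs k l] by (simp add: *)
  qed (simp_all add: * alternating_form_add[OF assms(1)] alternating_form_scale[OF assms(1)])
qed

lemma alternating_form_sum: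
  fixes t :: "'i \<Rightarrow> 'g::ab_group_add list \<Rightarrow> 'k::field"
  assumes "\<And>i. i \<in> I \<Longrightarrow> alternating_form scK scA n (t i)"
  shows "alternating_form scK scA n (\<lambda>xs. \<Sum>i\<in>I. t i xs)"
proof (rule alternating_formI)
  fix xs :: "'g list" and k l a
  assume "length xs = n" "k < n" "l < n" "k \<noteq> l"
  then show "(\<Sum>i\<in>I. t i (xs[k := scA a (xs ! k)])) = (\<Sum>i\<in>I. t i (xs[l := scA a (xs ! l)]))"
    by (intro sum.cong refl alternating_form_balanced[OF assms])
next
  fix xs :: "'g list" and k l
  assume *: "length xs = n" "k < n" "l < n" "k \<noteq> l" "xs ! k = xs ! l"
  show "(\<Sum>i\<in>I. t i xs) = 0"
    by (rule sum.neutral) (use alternating_form_eq[OF assms] * in blast)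
qed (simp_all add: alternating_form_add[OF assms] alternating_form_scale[OF assms]
    sum.distrib sum_distrib_left)

lemma alternating_form_mult:
  fixes t :: "'g::ab_group_add list \<Rightarrow> 'k::field"
  assumes "alternating_form scK scA n t"
  shows "alternating_form scK scA n (\<lambda>xs. c * t xs)"
proof (rule alternating_formI)
  fix xs :: "'g list" and k l a
  assume "length xs = n" "k < n" "l < n" "k \<noteq> l"
  then show "c * t (xs[k := scA a (xs ! k)]) = c * t (xs[l := scA a (xs ! l)])"
    by (metis alternating_form_balanced[OF assms])
next
  fix xs :: "'g list" and k l
  assume "length xs = n" "k < n" "l < n" "k \<noteq> l" "xs ! k = xs ! l"
  then show "c * t xs = 0"
    using alternating_form_eq[OF assms] by (metis mult_zero_right)
qed (simp_all add: alternating_form_add[OF assms] alternating_form_scale[OF assms] algebra_simps)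

lemma alternating_form_infix:
  fixes t :: "'g::ab_group_add list \<Rightarrow> 'k::field"
  assumes "alternating_form scK scA (length us + n + length vs) t"
  shows "alternating_form scK scA n (\<lambda>xs. t (us @ xs @ vs))"
proof (rule alternating_formI)
  fix xs :: "'g list" and k x y
  assume "length xs = n" "k < n"
  then show "t (us @ xs[k := x + y] @ vs) = t (us @ xs[k := x] @ vs) + t (us @ xs[k := y] @ vs)"
    using alternating_form_add[OF assms, of "us @ xs @ vs" "length us + k"]
    by (simp add: list_update_append)
next
  fix xs :: "'g list" and k c x
  assume "length xs = n" "k < n"
  then show "t (us @ xs[k := scA (scK c 1) x] @ vs) = c * t (us @ xs[k := x] @ vs)"
    using alternating_form_scale[OF assms, of "us @ xs @ vs" "length us + k"]
    by (simp add: list_update_append)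
next
  fix xs :: "'g list" and k l a
  assume "length xs = n" "k < n" "l < n" "k \<noteq> l"
  then show "t (us @ xs[k := scA a (xs ! k)] @ vs) = t (us @ xs[l := scA a (xs ! l)] @ vs)"
    using alternating_form_balanced[OF assms, of "us @ xs @ vs" "length us + k" "length us + l" a]
    by (simp add: list_update_append nth_append)
next
  fix xs :: "'g list" and k l
  assume "length xs = n" "k < n" "l < n" "k \<noteq> l" "xs ! k = xs ! l"
  then show "t (us @ xs @ vs) = 0"
    using alternating_form_eq[OF assms, of "us @ xs @ vs" "length us + k" "length us + l"]
    by (simp add: nth_append)
qed

text \<open>Polarization: with \<open>x + y\<close> in both places the form vanishes, and additivity
  in each place leaves only the two mixed terms.\<close>

lemma alternating_form_swap:
  fixes t :: "'g::ab_group_add list \<Rightarrow> 'k::field"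
  assumes "alternating_form scK scA n t" "length xs = n" "k < n" "l < n" "k \<noteq> l"
  shows "t (xs[k := x, l := y]) = - t (xs[k := y, l := x])"
proof -
  note [simp] = assms(2-5) assms(5)[symmetric]
  note add = alternating_form_add[OF assms(1)]
  have add_k: "t (xs[k := u + v, l := w]) = t (xs[k := u, l := w]) + t (xs[k := v, l := w])" for u v w
    using add[of "xs[l := w]" k] by (simp add: list_update_swap[of l k])
  have zero: "t (xs[k := u, l := u]) = 0" for u
    by (rule alternating_form_eq[OF assms(1), of _ k l]) simp_all
  have "t (xs[k := x + y, l := x + y]) = t (xs[k := x, l := y]) + t (xs[k := y, l := x])"
    by (simp add: add add_k zero[of x] zero[of y])
  with zero[of "x + y"] have "t (xs[k := x, l := y]) + t (xs[k := y, l := x]) = 0"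
    by (rule trans[OF sym, rotated])
  then show ?thesis
    by (simp only: eq_neg_iff_add_eq_0)
qed

text \<open>Moving \<open>x\<close> past \<open>vs\<close> is a chain of adjacent transpositions;
  the induction hands the entries of \<open>vs\<close> over to \<open>us\<close> one at a
  time.\<close>

lemma alternating_form_move:
  assumes "alternating_form scK scA n t" "length us + length vs + length ws + 1 = n"
  shows "t (us @ x # vs @ ws) = (-1) ^ length vs * t (us @ vs @ x # ws)"
  using assms(2)
proof (induction vs arbitrary: us)
  case (Cons v vs)
  have "t (us @ x # v # vs @ ws) = - t (us @ v # x # vs @ ws)"
    using alternating_form_swap[OF assms(1), of "us @ x # v # vs @ ws" "length us" "Suc (length us)" x v]
      Cons.prems by (simp add: list_update_append)
  moreover have "t ((us @ [v]) @ x # vs @ ws) = (-1) ^ length vs * t ((us @ [v]) @ vs @ x # ws)"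
    using Cons.prems by (intro Cons.IH) simp
  ultimately show ?case
    by simp
qed simp

text \<open>If two entries agree, balancing lets the factor act on either of them, and exchanging the two
  changes the sign; so twice the value vanishes.\<close>

lemma alternating_form_act:
  fixes scK :: "'k::field_char_0 \<Rightarrow> 'a::{comm_ring, comm_monoid_mult} \<Rightarrow> 'a"
    and t :: "'g::ab_group_add list \<Rightarrow> 'k"
  assumes t: "alternating_form scK scA n t" and "m < n"
    and act: "\<And>a x y. scA a (x + y) = scA a x + scA a y" "\<And>a b x. scA a (scA b x) = scA b (scA a x)"
  shows "alternating_form scK scA n (\<lambda>xs. t (xs[m := scA b (xs ! m)]))"
proof (rule alternating_formI)
  fix xs :: "'g list" and k x y
  assume "length xs = n" "k < n"
  then show "t (xs[k := x + y, m := scA b (xs[k := x + y] ! m)])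
      = t (xs[k := x, m := scA b (xs[k := x] ! m)]) + t (xs[k := y, m := scA b (xs[k := y] ! m)])"
    using alternating_form_add[OF t, of xs m] alternating_form_add[OF t, of "xs[m := scA b (xs ! m)]" k]
    by (cases "k = m") (simp_all add: act list_update_swap[of k m])
next
  fix xs :: "'g list" and k c x
  assume "length xs = n" "k < n"
  then show "t (xs[k := scA (scK c 1) x, m := scA b (xs[k := scA (scK c 1) x] ! m)])
      = c * t (xs[k := x, m := scA b (xs[k := x] ! m)])"
    using alternating_form_scale[OF t, of xs m] alternating_form_scale[OF t, of "xs[m := scA b (xs ! m)]" k]
    by (cases "k = m") (simp_all add: act(2)[of b] list_update_swap[of k m])
next
  fix xs :: "'g list" and k l a
  assume *: "length xs = n" "k < n" "l < n" "k \<noteq> l"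
  have "t (xs[k := scA a (xs ! k), m := scA b (xs[k := scA a (xs ! k)] ! m)])
      = t (xs[m := scA b (xs ! m), k := scA a (xs[m := scA b (xs ! m)] ! k)])" for k
    by (cases "k = m"; cases "k < length xs") (simp_all add: act(2)[of a] list_update_swap[of k m] list_update_beyond)
  then show "t (xs[k := scA a (xs ! k), m := scA b (xs[k := scA a (xs ! k)] ! m)])
      = t (xs[l := scA a (xs ! l), m := scA b (xs[l := scA a (xs ! l)] ! m)])"
    using alternating_form_balanced[OF t, of "xs[m := scA b (xs ! m)]" k l a] * by simp
next
  fix xs :: "'g list" and k l
  assume *: "length xs = n" "k < n" "l < n" "k \<noteq> l" "xs ! k = xs ! l"
  let ?s = "\<lambda>m. t (xs[m := scA b (xs ! m)])"
  have "?s k = - ?s l"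
    using alternating_form_swap[OF t, of xs k l "scA b (xs ! k)" "xs ! k"] *
    by (simp add: list_update_swap[of k l]) (metis list_update_id list_update_swap)
  moreover have "?s m = ?s k" "?s m = ?s l"
    using alternating_form_balanced[OF t _ \<open>m < n\<close>] * by blast+
  ultimately show "?s m = 0"
    by simp
qed

section \<open>Tuples with an entry omitted, and contractions\<close>

lemma length_omit [simp]: "i < length xs \<Longrightarrow> length (omit (Suc i) xs) = length xs - 1"
  by (simp add: omit_def)

lemma omit_update_same [simp]: "omit (Suc i) (xs[i := v]) = omit (Suc i) xs"
  by (simp add: omit_def)

text \<open>The position, counted from \<open>0\<close>, to which entry \<open>k\<close> moves when
  a different entry \<open>i\<close> is dropped. Since \<open>omit\<close> counts from
  \<open>1\<close>, it is paired with \<open>omit (Suc i)\<close>.\<close>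

definition skip :: "nat \<Rightarrow> nat \<Rightarrow> nat" where
  "skip i k = (if k < i then k else k - 1)"

lemma skip_less: "i \<noteq> k \<Longrightarrow> i < Suc n \<Longrightarrow> k < Suc n \<Longrightarrow> skip i k < n"
  by (auto simp: skip_def)

lemma skip_inject: "i \<noteq> k \<Longrightarrow> i \<noteq> l \<Longrightarrow> skip i k = skip i l \<longleftrightarrow> k = l"
  by (auto simp: skip_def)

lemma omit_update:
  assumes "i \<noteq> k" "i < length xs"
  shows "omit (Suc i) (xs[k := v]) = (omit (Suc i) xs)[skip i k := v]"
proof (cases "k < i")
  case True
  then show ?thesis
    using assms by (simp add: omit_def skip_def list_update_append take_update_swap drop_update_cancel)
next
  case False
  then obtain d where "k = Suc (i + d)"
    using assms by (metis less_imp_Suc_add linorder_neqE_nat)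
  then show ?thesis
    using assms by (simp add: omit_def skip_def list_update_append drop_update_swap)
qed

lemma nth_omit: "i \<noteq> k \<Longrightarrow> i < length xs \<Longrightarrow> k < length xs \<Longrightarrow> omit (Suc i) xs ! skip i k = xs ! k"
  by (auto simp: omit_def skip_def nth_append min_def)

text \<open>Terms that do not contract a changed entry inherit every property from \<open>E\<close>.
  In the balancing relation the terms \<open>k\<close> and \<open>l\<close> leave two defects
  \<open>N\<close>, which cancel by the assumption on \<open>N\<close>. When two entries coincide,
  the terms contracting them differ by a move across the entries in between and cancel.\<close>

lemma alternating_form_contraction:
  fixes E :: "'g::ab_group_add \<Rightarrow> 'g list \<Rightarrow> 'k::field"
  assumes alt: "\<And>x. alternating_form scK scA n (E x)"
    and add: "\<And>x y zs. length zs = n \<Longrightarrow> E (x + y) zs = E x zs + E y zs"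
    and scale: "\<And>c x zs. length zs = n \<Longrightarrow> E (scA (scK c 1) x) zs = c * E x zs"
    and act: "\<And>a x zs m. length zs = n \<Longrightarrow> m < n \<Longrightarrow>
      E (scA a x) zs = E x (zs[m := scA a (zs ! m)]) + N a x zs"
    and N: "\<And>a xs i j. length xs = Suc n \<Longrightarrow> i \<le> n \<Longrightarrow> j \<le> n \<Longrightarrow>
      (-1) ^ i * N a (xs ! i) (omit (Suc i) xs) = (-1) ^ j * N a (xs ! j) (omit (Suc j) xs)"
  shows "alternating_form scK scA (Suc n)
    (\<lambda>xs. \<Sum>i\<le>n. (-1) ^ i * E (xs ! i) (omit (Suc i) xs))"
proof (rule alternating_formI)
  fix xs :: "'g list" and k x y
  assume *: "length xs = Suc n" "k < Suc n"
  have "(-1) ^ i * E (xs[k := x + y] ! i) (omit (Suc i) (xs[k := x + y]))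
      = (-1) ^ i * E (xs[k := x] ! i) (omit (Suc i) (xs[k := x]))
        + (-1) ^ i * E (xs[k := y] ! i) (omit (Suc i) (xs[k := y]))" if "i \<le> n" for i
    using * that by (cases "i = k")
      (simp_all add: add omit_update alternating_form_add[OF alt] skip_less distrib_left)
  then show "(\<Sum>i\<le>n. (-1) ^ i * E (xs[k := x + y] ! i) (omit (Suc i) (xs[k := x + y])))
      = (\<Sum>i\<le>n. (-1) ^ i * E (xs[k := x] ! i) (omit (Suc i) (xs[k := x])))
        + (\<Sum>i\<le>n. (-1) ^ i * E (xs[k := y] ! i) (omit (Suc i) (xs[k := y])))"
    by (simp add: sum.distrib[symmetric])
next
  fix xs :: "'g list" and k c x
  assume *: "length xs = Suc n" "k < Suc n"
  have "(-1) ^ i * E (xs[k := scA (scK c 1) x] ! i) (omit (Suc i) (xs[k := scA (scK c 1) x]))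
      = c * ((-1) ^ i * E (xs[k := x] ! i) (omit (Suc i) (xs[k := x])))" if "i \<le> n" for i
    using * that by (cases "i = k")
      (simp_all add: scale omit_update alternating_form_scale[OF alt] skip_less)
  then show "(\<Sum>i\<le>n. (-1) ^ i * E (xs[k := scA (scK c 1) x] ! i)
          (omit (Suc i) (xs[k := scA (scK c 1) x])))
      = c * (\<Sum>i\<le>n. (-1) ^ i * E (xs[k := x] ! i) (omit (Suc i) (xs[k := x])))"
    by (simp add: sum_distrib_left mult.left_commute)
next
  fix xs :: "'g list" and k l a
  assume *: "length xs = Suc n" "k < Suc n" "l < Suc n" "k \<noteq> l"
  let ?e = "\<lambda>xs i. (-1) ^ i * E (xs ! i) (omit (Suc i) xs)"
  let ?xk = "xs[k := scA a (xs ! k)]" and ?xl = "xs[l := scA a (xs ! l)]"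
  have "?e ?xk i = ?e ?xl i" if "i \<le> n" "i \<noteq> k" "i \<noteq> l" for i
    using * that alternating_form_balanced[OF alt, of "omit (Suc i) xs" "skip i k" "skip i l"]
    by (simp add: omit_update skip_less nth_omit)
  then have "(\<Sum>i\<le>n. ?e ?xk i - ?e ?xl i) = (\<Sum>i\<in>{k, l}. ?e ?xk i - ?e ?xl i)"
    using * by (intro sum.mono_neutral_right) auto
  \<comment> \<open>For \<open>i = k\<close> the factor \<open>a\<close> sits on the contracted
    entry of the first tuple, and \<open>act\<close> carries it to the place of entry
    \<open>l\<close>, where the second tuple has it; what remains is the defect. For
    \<open>i = l\<close> the roles are exchanged, hence the minus sign.\<close>
  also have "\<dots> = (-1) ^ k * N a (xs ! k) (omit (Suc k) xs) - (-1) ^ l * N a (xs ! l) (omit (Suc l) xs)"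
    using * act[of "omit (Suc k) xs" "skip k l"] act[of "omit (Suc l) xs" "skip l k"]
    by (simp add: omit_update nth_omit skip_less algebra_simps)
  also have "\<dots> = 0"
    using N[of xs k l a] * by simp
  finally show "sum (?e ?xk) {..n} = sum (?e ?xl) {..n}"
    by (simp add: sum_subtractf)
next
  fix xs :: "'g list" and k l
  assume "length xs = Suc n" "k < Suc n" "l < Suc n" "k \<noteq> l" "xs ! k = xs ! l"
  then show "(\<Sum>i\<le>n. (-1) ^ i * E (xs ! i) (omit (Suc i) xs)) = 0"
  proof (induction k l rule: linorder_wlog)
    case (le k l)
    let ?e = "\<lambda>i. (-1) ^ i * E (xs ! i) (omit (Suc i) xs)"
    have "?e i = 0" if "i \<le> n" "i \<noteq> k" "i \<noteq> l" for i
      using le that alternating_form_eq[OF alt, of "omit (Suc i) xs" "skip i k" "skip i l"]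
      by (simp add: skip_less nth_omit skip_inject)
    then have "sum ?e {..n} = sum ?e {k, l}"
      using le by (intro sum.mono_neutral_right) auto
    also have "\<dots> = 0"
    proof -
      \<comment> \<open>The tuple is cut at its two equal entries. Contracting either copy of
        \<open>x\<close> leaves the other one, and the two remaining tuples differ by moving it
        across \<open>vs\<close>.\<close>
      define x us vs ws where "x = xs ! k" and "us = take k xs"
        and "vs = take (l - Suc k) (drop (Suc k) xs)" and "ws = drop (Suc l) xs"
      have len: "length us = k" "length vs = l - Suc k" "length ws = n - l"
        using le by (simp_all add: us_def vs_def ws_def)
      have "drop (Suc k) xs = vs @ drop (l - Suc k) (drop (Suc k) xs)"
        by (simp only: vs_def append_take_drop_id)
      also have "drop (l - Suc k) (drop (Suc k) xs) = drop l xs"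
        using le by simp
      also have "\<dots> = x # ws"
        using le by (simp add: ws_def x_def Cons_nth_drop_Suc)
      finally have d: "drop (Suc k) xs = vs @ x # ws" .
      have "xs = take k xs @ xs ! k # drop (Suc k) xs"
        using le by (intro id_take_nth_drop) simp
      also have "\<dots> = us @ x # vs @ x # ws"
        by (simp only: d us_def x_def)
      finally have xs: "xs = us @ x # vs @ x # ws" .
      have kl: "k = length us" "l = Suc (length us + length vs)"
        using len le by simp_all
      have "omit (Suc k) xs = us @ vs @ x # ws" "omit (Suc l) xs = us @ x # vs @ ws"
        using kl by (simp_all add: omit_def xs)
      moreover have "E x (us @ x # vs @ ws) = (-1) ^ length vs * E x (us @ vs @ x # ws)"
        using len le by (intro alternating_form_move[OF alt]) simp
      \<comment> \<open>Exactly \<open>l - k - 1\<close> entries lie in between, so the sign of the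
        move and the two contraction signs have an odd total exponent.\<close>
      moreover have "(-1 :: 'k) ^ l * (-1) ^ length vs = - ((-1) ^ k)"
      proof -
        have "l + length vs = Suc (k + 2 * length vs)"
          using len le by simp
        then show ?thesis
          by (metis power_add power_Suc mult_minus1 power_minus1_even mult.right_neutral)
      qed
      ultimately show ?thesis
        using le by (simp add: x_def[symmetric] mult.assoc[symmetric])
    qed
    finally show ?case .
  next
    case (sym k l)
    then show ?case by metis
  qed
qed

text \<open>The vector \<open>z\<close> travels from the front into the gap left by the omitted
  entry, past \<open>us\<close> and the first \<open>i\<close> entries of \<open>xs\<close>.\<close>

lemma alternating_form_insert:
  assumes "alternating_form scK scA (length us + length xs + length vs) t" "i < length xs"
  shows "t (z # us @ omit (Suc i) xs @ vs) = (-1) ^ (length us + i) * t (us @ xs[i := z] @ vs)"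
proof -
  have "t ([] @ z # (us @ take i xs) @ drop (Suc i) xs @ vs)
      = (-1) ^ length (us @ take i xs) * t ([] @ (us @ take i xs) @ z # drop (Suc i) xs @ vs)"
    using assms(2) by (intro alternating_form_move[OF assms(1)]) simp
  then show ?thesis
    using assms(2) by (simp add: omit_def upd_conv_take_nth_drop)
qed

text \<open>This is meant for \<open>D\<close> a bracket with one fixed element, \<open>d\<close>
  being the coefficient of its anchor term. The defect of balancing is the form with
  \<open>scA (d a) x\<close> in front. Putting this entry back into its own slot absorbs
  \<open>(-1) ^ i\<close> up to the fixed sign \<open>(-1) ^ length us\<close>, and by balancing the
  result does not depend on which entry \<open>d a\<close> acts on.\<close>

lemma alternating_form_derivation:
  fixes t :: "'g::ab_group_add list \<Rightarrow> 'k::field"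
  assumes t: "alternating_form scK scA (length us + Suc n + length vs) t"
    and add: "\<And>x y. D (x + y) = D x + D y"
    and scale: "\<And>c x. D (scA (scK c 1) x) = scA (scK c 1) (D x)"
    and act: "\<And>a x. D (scA a x) = scA a (D x) + scA (d a) x"
  shows "alternating_form scK scA (Suc n)
    (\<lambda>xs. \<Sum>i\<le>n. (-1) ^ i * t (D (xs ! i) # us @ omit (Suc i) xs @ vs))"
proof (rule alternating_form_contraction[where N = "\<lambda>a x zs. t (scA (d a) x # us @ zs @ vs)"])
  have front: "t ((x + y) # us @ zs @ vs) = t (x # us @ zs @ vs) + t (y # us @ zs @ vs)"
    "t (scA (scK c 1) x # us @ zs @ vs) = c * t (x # us @ zs @ vs)"
    if "length zs = n" for x y c zs
    using that alternating_form_add[OF t, of "x # us @ zs @ vs" 0 x y]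
      alternating_form_scale[OF t, of "x # us @ zs @ vs" 0 c x] by simp_all
  show "alternating_form scK scA n (\<lambda>zs. t (D x # us @ zs @ vs))" for x
    using t by (intro alternating_form_infix[of _ _ "D x # us" _ vs, simplified]) simp
  fix zs :: "'g list" and x y a c
  assume zs: "length zs = n"
  then show "t (D (x + y) # us @ zs @ vs) = t (D x # us @ zs @ vs) + t (D y # us @ zs @ vs)"
    and "t (D (scA (scK c 1) x) # us @ zs @ vs) = c * t (D x # us @ zs @ vs)"
    by (simp_all add: add scale front)
  fix m
  assume "m < n"
  \<comment> \<open>The Leibniz rule splits \<open>D (scA a x)\<close>; in the term
    \<open>scA a (D x)\<close> balancing carries \<open>a\<close> from the front to entry
    \<open>m\<close> of \<open>zs\<close>.\<close>
  with zs show "t (D (scA a x) # us @ zs @ vs)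
      = t (D x # us @ zs[m := scA a (zs ! m)] @ vs) + t (scA (d a) x # us @ zs @ vs)"
    using alternating_form_balanced[OF t, of "D x # us @ zs @ vs" 0 "Suc (length us + m)" a]
    by (simp add: act front nth_append list_update_append)
next
  fix a and xs :: "'g list" and i j
  assume *: "length xs = Suc n" "i \<le> n" "j \<le> n"
  have "(-1) ^ i * t (scA (d a) (xs ! i) # us @ omit (Suc i) xs @ vs)
      = (-1) ^ length us * t (us @ xs[i := scA (d a) (xs ! i)] @ vs)" if "i \<le> n" for i
    using alternating_form_insert[of scK scA us xs vs t i] t * that
    by (simp add: power_add mult.assoc[symmetric] mult.commute[of "(-1) ^ i"] power_mult_distrib[symmetric])
  moreover have "t (us @ xs[i := scA (d a) (xs ! i)] @ vs) = t (us @ xs[j := scA (d a) (xs ! j)] @ vs)"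
    using alternating_form_balanced[OF alternating_form_infix[OF t], of xs i j] * by simp
  ultimately show "(-1) ^ i * t (scA (d a) (xs ! i) # us @ omit (Suc i) xs @ vs)
      = (-1) ^ j * t (scA (d a) (xs ! j) # us @ omit (Suc j) xs @ vs)"
    using * by simp
qed

section \<open>Cosets and functionals\<close>

text \<open>A maximal independent subset \<open>B\<close> of \<open>S\<close> stays independent when
  \<open>u\<close> is added, so the values \<open>1\<close> at \<open>u\<close> and \<open>0\<close>
  on \<open>B\<close> extend to a linear functional; it kills \<open>S\<close>, which lies in the
  span of \<open>B\<close>.\<close>

lemma (in vector_space) functional_separates_span:
  assumes "u \<notin> span S"
  obtains \<phi> where "Vector_Spaces.linear scale (*) \<phi>" "\<forall>v\<in>S. \<phi> v = 0" "\<phi> u \<noteq> 0"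
proof -
  interpret vector_space_pair scale "(*)"
    by unfold_locales (simp_all add: algebra_simps)
  obtain B where B: "B \<subseteq> S" "independent B" "S \<subseteq> span B"
    using maximal_independent_subset .
  have u: "u \<notin> span B"
    using assms span_mono[OF B(1)] by blast
  then have "independent (insert u B)"
    using B(2) by (simp add: independent_insert)
  then obtain \<phi> where \<phi>: "Vector_Spaces.linear scale (*) \<phi>"
      "\<forall>v\<in>insert u B. \<phi> v = (if v = u then 1 else 0)"
    using linear_independent_extend[of "insert u B" "\<lambda>v. if v = u then 1 else 0"] by auto
  have "\<phi> v = 0" if "v \<in> B" for v
    using \<phi>(2) that u span_base by fastforce
  then have "\<phi> v = 0" if "v \<in> S" for v
    using linear_eq_0_on_span[OF \<phi>(1)] B(3) that by blast
  then show ?thesis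
    using that \<phi> by simp
qed

section \<open>Representatives as a vector space: generators and relations\<close>

context lie_rinehart
begin

sublocale rep: vector_space "rep_scale scK :: 'k \<Rightarrow> 'a \<times> ('g list \<Rightarrow>\<^sub>0 'k) \<Rightarrow> _"
  by unfold_locales
    (simp_all add: rep_scale_def prod_eq_iff A.scale_right_distrib A.scale_left_distrib
      free.scale_right_distrib free.scale_left_distrib)

abbreviation (input) ext_linear :: "('a \<times> ('g list \<Rightarrow>\<^sub>0 'k) \<Rightarrow> 'k) \<Rightarrow> bool" where
  "ext_linear \<equiv> Vector_Spaces.linear (rep_scale scK) (*)"

lemma ext_linear_iff:
  "ext_linear \<phi> \<longleftrightarrow> (\<forall>v w. \<phi> (v + w) = \<phi> v + \<phi> w) \<and> (\<forall>c v. \<phi> (rep_scale scK c v) = c * \<phi> v)"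
proof -
  have "vector_space ((*) :: 'k \<Rightarrow> 'k \<Rightarrow> 'k)"
    by unfold_locales (simp_all add: algebra_simps)
  then show ?thesis
    using rep.vector_space_axioms by (auto simp: Vector_Spaces.linear_iff)
qed

lemma ext_linearD:
  assumes "ext_linear \<phi>"
  shows "\<phi> (v + w) = \<phi> v + \<phi> w" "\<phi> (v - w) = \<phi> v - \<phi> w" "\<phi> (rep_scale scK c v) = c * \<phi> v"
    "\<phi> (sum h I) = (\<Sum>i\<in>I. \<phi> (h i))"
proof -
  interpret \<phi>: Vector_Spaces.linear "rep_scale scK" "(*)" \<phi>
    by fact
  show "\<phi> (v + w) = \<phi> v + \<phi> w" "\<phi> (v - w) = \<phi> v - \<phi> w" "\<phi> (rep_scale scK c v) = c * \<phi> v"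
    "\<phi> (sum h I) = (\<Sum>i\<in>I. \<phi> (h i))"
    by (rule \<phi>.add \<phi>.diff \<phi>.scale \<phi>.sum)+
qed

lemma ext_linear_eq_0_on_span:
  assumes "ext_linear \<phi>" "\<And>v. v \<in> S \<Longrightarrow> \<phi> v = 0" "v \<in> rep.span S"
  shows "\<phi> v = 0"
proof -
  interpret \<phi>: Vector_Spaces.linear "rep_scale scK" "(*)" \<phi>
    by fact
  show ?thesis
    using \<phi>.eq_0_on_span assms(2,3) by blast
qed

text \<open>A spanning set of \<open>ext_reps p\<close>, consisting of the representatives at which
  the bracket formulas are stated.\<close>

definition gens :: "nat \<Rightarrow> ('a \<times> ('g list \<Rightarrow>\<^sub>0 'k)) set" where
  "gens p = (if p = 0 then range scalar else tuple ` {xs. length xs = p})"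

definition rels :: "nat \<Rightarrow> ('a \<times> ('g list \<Rightarrow>\<^sub>0 'k)) set" where
  "rels p = (if p = 0 then {} else Pair 0 ` ext_relators scK scA p)"

lemma subspace_ext_reps: "rep.subspace (ext_reps p)"
proof (rule rep.subspaceI)
  fix v w :: "'a \<times> ('g list \<Rightarrow>\<^sub>0 'k)" and c
  assume "v \<in> ext_reps p" "w \<in> ext_reps p"
  then show "v + w \<in> ext_reps p" "rep_scale scK c v \<in> ext_reps p"
    by (fastforce simp: ext_reps_def rep_scale_def in_keys_iff lookup_add split: if_splits)+
qed (auto simp: ext_reps_def zero_prod_def)

lemma gens_subset_reps: "gens p \<subseteq> ext_reps p"
  by (auto simp: gens_def ext_reps_def scalar_def tuple_def)

lemma single_eq_scale_tuple: "(0, Poly_Mapping.single xs c) = rep_scale scK c (tuple xs)"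
  by (auto simp: tuple_def rep_scale_def intro!: poly_mapping_eqI simp: lookup_single when_def)

lemma reps_subset_span: "ext_reps p \<subseteq> rep.span (gens p)"
proof
  fix w :: "'a \<times> ('g list \<Rightarrow>\<^sub>0 'k)"
  assume w: "w \<in> ext_reps p"
  show "w \<in> rep.span (gens p)"
  proof (cases "p = 0")
    case True
    then have "w \<in> gens p"
      using w by (auto simp: gens_def ext_reps_def scalar_def)
    then show ?thesis
      by (rule rep.span_base)
  next
    case False
    let ?s = "\<lambda>xs. rep_scale scK (Poly_Mapping.lookup (snd w) xs) (tuple xs)"
    have "w = (\<Sum>xs\<in>Poly_Mapping.keys (snd w). ?s xs)"
    proof -
      have "snd w = (\<Sum>xs\<in>Poly_Mapping.keys (snd w). Poly_Mapping.single xs (Poly_Mapping.lookup (snd w) xs))"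
        by (intro poly_mapping_eqI)
          (simp add: Poly_Mapping.lookup_sum lookup_single when_def sum.delta in_keys_iff)
      moreover have "fst w = 0"
        using w False by (auto simp: ext_reps_def)
      ultimately show ?thesis
        by (auto simp: prod_eq_iff fst_sum snd_sum single_eq_scale_tuple[symmetric])
    qed
    moreover have "?s xs \<in> rep.span (gens p)" if "xs \<in> Poly_Mapping.keys (snd w)" for xs
      using that w False by (intro rep.span_scale rep.span_base) (auto simp: gens_def ext_reps_def)
    ultimately show ?thesis
      by (metis (no_types, lifting) rep.span_sum)
  qed
qed

text \<open>Written through \<open>tuple\<close>, the relators can be evaluated by linear
  functionals on representatives.\<close>

lemma rels_eq:
  assumes "p \<noteq> 0"
  shows "rels p =
     {tuple (xs[k := x + y]) - tuple (xs[k := x]) - tuple (xs[k := y])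
      | xs k x y. length xs = p \<and> k < p}
   \<union> {tuple (xs[k := scA (scK c 1) x]) - rep_scale scK c (tuple (xs[k := x]))
      | xs k c x. length xs = p \<and> k < p}
   \<union> {tuple (xs[k := scA a (xs ! k)]) - tuple (xs[l := scA a (xs ! l)])
      | xs k l a. length xs = p \<and> k < p \<and> l < p \<and> k \<noteq> l}
   \<union> {tuple xs | xs k l. length xs = p \<and> k < p \<and> l < p \<and> k \<noteq> l \<and> xs ! k = xs ! l}"
proof -
  have *: "Pair (0 :: 'a) (u - v) = Pair 0 u - Pair 0 v"
      "Pair (0 :: 'a) (Poly_Mapping.single xs 1) = tuple xs"
    for u v :: "'g list \<Rightarrow>\<^sub>0 'k" and xs
    by (simp_all add: tuple_def)
  have "rels p = Pair 0 ` ext_relators scK scA p"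
    using assms by (simp add: rels_def)
  also have "\<dots> =
     {Pair 0 (Poly_Mapping.single (xs[k := x + y]) 1
        - Poly_Mapping.single (xs[k := x]) 1 - Poly_Mapping.single (xs[k := y]) 1)
      | xs k x y. length xs = p \<and> k < p}
   \<union> {Pair 0 (Poly_Mapping.single (xs[k := scA (scK c 1) x]) 1 - Poly_Mapping.single (xs[k := x]) c)
      | xs k c x. length xs = p \<and> k < p}
   \<union> {Pair 0 (Poly_Mapping.single (xs[k := scA a (xs ! k)]) 1
        - Poly_Mapping.single (xs[l := scA a (xs ! l)]) 1)
      | xs k l a. length xs = p \<and> k < p \<and> l < p \<and> k \<noteq> l}
   \<union> {Pair 0 (Poly_Mapping.single xs 1)
      | xs k l. length xs = p \<and> k < p \<and> l < p \<and> k \<noteq> l \<and> xs ! k = xs ! l}"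
    unfolding ext_relators_def image_Un by (intro arg_cong2[where f = "(\<union>)"]; blast)
  finally show ?thesis
    by (simp only: * single_eq_scale_tuple rep.scale_one)
qed

lemma rels_subset_reps: "rels p \<subseteq> ext_reps p"
proof (cases "p = 0")
  case False
  then have "(tuple xs :: 'a \<times> ('g list \<Rightarrow>\<^sub>0 'k)) \<in> ext_reps p" if "length xs = p" for xs
    using that gens_subset_reps[of p] by (simp add: gens_def image_subset_iff)
  then show ?thesis
    unfolding rels_eq[OF False]
    by (auto intro!: rep.subspace_diff[OF subspace_ext_reps] rep.subspace_scale[OF subspace_ext_reps])
qed (simp add: rels_def)

text \<open>Evaluating \<phi> on the four families of relators yields the four clauses of
  \<open>alternating_form\<close>. This turns questions about the quotient into questions about
  forms on tuples.\<close>

lemma vanish_rels_iff_alternating_form: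
  assumes \<phi>: "ext_linear \<phi>" and "p \<noteq> 0"
  shows "(\<forall>v\<in>rels p. \<phi> v = 0) \<longleftrightarrow> alternating_form scK scA p (\<lambda>xs. \<phi> (tuple xs))"
proof
  assume *: "\<forall>v\<in>rels p. \<phi> v = 0"
  show "alternating_form scK scA p (\<lambda>xs. \<phi> (tuple xs))"
  proof (rule alternating_formI)
    fix xs :: "'g list" and k x y
    assume "length xs = p" "k < p"
    then have "tuple (xs[k := x + y]) - tuple (xs[k := x]) - tuple (xs[k := y]) \<in> rels p"
      unfolding rels_eq[OF \<open>p \<noteq> 0\<close>] by blast
    from bspec[OF * this] show "\<phi> (tuple (xs[k := x + y])) = \<phi> (tuple (xs[k := x])) + \<phi> (tuple (xs[k := y]))"
      by (simp add: ext_linearD[OF \<phi>] algebra_simps)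
  next
    fix xs :: "'g list" and k c x
    assume "length xs = p" "k < p"
    then have "tuple (xs[k := scA (scK c 1) x]) - rep_scale scK c (tuple (xs[k := x])) \<in> rels p"
      unfolding rels_eq[OF \<open>p \<noteq> 0\<close>] by blast
    from bspec[OF * this] show "\<phi> (tuple (xs[k := scA (scK c 1) x])) = c * \<phi> (tuple (xs[k := x]))"
      by (simp add: ext_linearD[OF \<phi>])
  next
    fix xs :: "'g list" and k l a
    assume "length xs = p" "k < p" "l < p" "k \<noteq> l"
    then have "tuple (xs[k := scA a (xs ! k)]) - tuple (xs[l := scA a (xs ! l)]) \<in> rels p"
      unfolding rels_eq[OF \<open>p \<noteq> 0\<close>] by blast
    from bspec[OF * this]
    show "\<phi> (tuple (xs[k := scA a (xs ! k)])) = \<phi> (tuple (xs[l := scA a (xs ! l)]))"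
      by (simp add: ext_linearD[OF \<phi>])
  next
    fix xs :: "'g list" and k l
    assume "length xs = p" "k < p" "l < p" "k \<noteq> l" "xs ! k = xs ! l"
    then have "tuple xs \<in> rels p"
      unfolding rels_eq[OF \<open>p \<noteq> 0\<close>] by blast
    with * show "\<phi> (tuple xs) = 0"
      by blast
  qed
next
  assume *: "alternating_form scK scA p (\<lambda>xs. \<phi> (tuple xs))"
  show "\<forall>v\<in>rels p. \<phi> v = 0"
  proof
    fix v
    assume "v \<in> rels p"
    then consider
        xs k x y where "length xs = p" "k < p"
          "v = tuple (xs[k := x + y]) - tuple (xs[k := x]) - tuple (xs[k := y])"
      | xs k c x where "length xs = p" "k < p"
          "v = tuple (xs[k := scA (scK c 1) x]) - rep_scale scK c (tuple (xs[k := x]))"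
      | xs k l a where "length xs = p" "k < p" "l < p"
          "v = tuple (xs[k := scA a (xs ! k)]) - tuple (xs[l := scA a (xs ! l)])"
      | xs k l where "length xs = p" "k < p" "l < p" "k \<noteq> l" "xs ! k = xs ! l" "v = tuple xs"
      unfolding rels_eq[OF \<open>p \<noteq> 0\<close>] by blast
    then show "\<phi> v = 0"
    proof cases
      case 1
      then show ?thesis
        by (simp add: ext_linearD[OF \<phi>] alternating_form_add[OF *])
    next
      case 2
      then show ?thesis
        by (simp add: ext_linearD[OF \<phi>] alternating_form_scale[OF *])
    next
      case (3 xs k l a)
      then show ?thesis
        using alternating_form_balanced[OF *, of xs k l a] by (simp add: ext_linearD[OF \<phi>])
    next
      case (4 xs k l)
      then show ?thesis
        using alternating_form_eq[OF *, of xs k l] by simp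
    qed
  qed
qed

section \<open>Cosets and their operations\<close>

lemma ext_rel_eq_span: "ext_rel scK scA p = rep.span (rels p)"
proof (cases "p = 0")
  case False
  interpret Pair: Vector_Spaces.linear free_scale "rep_scale scK" "Pair 0 :: ('g list \<Rightarrow>\<^sub>0 'k) \<Rightarrow> 'a \<times> _"
    by unfold_locales (simp_all add: rep_scale_def)
  show ?thesis
    using False by (auto simp: ext_rel_def rels_def Pair.span_image)
qed (simp add: ext_rel_def rels_def)

lemma ext_class_eq_iff:
  "ext_class scK scA p v = ext_class scK scA p w \<longleftrightarrow> v - w \<in> ext_rel scK scA p"
proof -
  have sub: "rep.subspace (ext_rel scK scA p)"
    by (simp add: ext_rel_eq_span)
  show ?thesis
  proof
    assume "ext_class scK scA p v = ext_class scK scA p w"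
    moreover have "v \<in> ext_class scK scA p v"
      using rep.subspace_0[OF sub] by (auto simp: ext_class_def elt_set_plus_def intro: bexI[of _ 0])
    ultimately show "v - w \<in> ext_rel scK scA p"
      by (auto simp: ext_class_def elt_set_plus_def)
  next
    assume *: "v - w \<in> ext_rel scK scA p"
    have "v + r \<in> w +o ext_rel scK scA p" if "r \<in> ext_rel scK scA p" for r
      using rep.subspace_add[OF sub * that] by (auto simp: elt_set_plus_def intro!: bexI[of _ "v - w + r"])
    moreover have "w + r \<in> v +o ext_rel scK scA p" if "r \<in> ext_rel scK scA p" for r
      using rep.subspace_diff[OF sub that *] by (auto simp: elt_set_plus_def intro!: bexI[of _ "r - (v - w)"])
    ultimately show "ext_class scK scA p v = ext_class scK scA p w"
      by (auto simp: ext_class_def elt_set_plus_def)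
  qed
qed

lemma ext_class_add:
  "ext_class scK scA p v + ext_class scK scA p w = ext_class scK scA p (v + w)"
proof -
  have sub: "rep.subspace (ext_rel scK scA p)"
    by (simp add: ext_rel_eq_span)
  have "ext_rel scK scA p + ext_rel scK scA p = ext_rel scK scA p"
    using rep.subspace_add[OF sub] rep.subspace_0[OF sub]
    by (auto simp: set_plus_def intro: bexI[of _ 0])
  then show ?thesis
    by (simp add: ext_class_def set_plus_rearrange)
qed

lemma ext_scale_ext_class:
  "ext_scale scK scA p c (ext_class scK scA p w) = ext_class scK scA p (rep_scale scK c w)"
proof -
  have sub: "rep.subspace (ext_rel scK scA p)"
    by (simp add: ext_rel_eq_span)
  have "(\<exists>u \<in> rep_scale scK c ` (w +o R). \<exists>s\<in>R. x = u + s) \<longleftrightarrow>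
      (\<exists>r s. x = rep_scale scK c (w + r) + s \<and> r \<in> R \<and> s \<in> R)" for x R
    unfolding elt_set_plus_def by blast
  then have "rep_scale scK c ` (w +o ext_rel scK scA p) + ext_rel scK scA p
      = {rep_scale scK c w + (rep_scale scK c r + s) | r s. r \<in> ext_rel scK scA p \<and> s \<in> ext_rel scK scA p}"
    by (simp only: set_plus_def rep.scale_right_distrib add.assoc)
  also have "\<dots> = rep_scale scK c w +o ext_rel scK scA p"
  proof
    show "rep_scale scK c w +o ext_rel scK scA p \<subseteq>
        {rep_scale scK c w + (rep_scale scK c r + s) | r s. r \<in> ext_rel scK scA p \<and> s \<in> ext_rel scK scA p}"
    proof
      fix x
      assume "x \<in> rep_scale scK c w +o ext_rel scK scA p"
      then obtain s where "s \<in> ext_rel scK scA p" "x = rep_scale scK c w + (rep_scale scK c 0 + s)"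
        unfolding elt_set_plus_def by auto
      then show "x \<in> {rep_scale scK c w + (rep_scale scK c r + s) | r s.
          r \<in> ext_rel scK scA p \<and> s \<in> ext_rel scK scA p}"
        using rep.subspace_0[OF sub] by blast
    qed
  qed (use rep.subspace_add[OF sub rep.subspace_scale[OF sub]] in \<open>auto simp: elt_set_plus_def\<close>)
  finally show ?thesis
    by (simp add: ext_scale_def ext_class_def)
qed

text \<open>Linear functionals on the exterior power, represented on all pairs; vanishing on
  \<open>rels p\<close> makes them constant on the cosets of degree \<open>p\<close>.\<close>

definition ext_functional :: "nat \<Rightarrow> ('a \<times> ('g list \<Rightarrow>\<^sub>0 'k) \<Rightarrow> 'k) \<Rightarrow> bool" where
  "ext_functional p \<phi> \<longleftrightarrow> ext_linear \<phi> \<and> (\<forall>v\<in>rels p. \<phi> v = 0)"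

text \<open>Functionals separate cosets: a difference outside the span of the relations is detected
  by one of them.\<close>

lemma ext_class_eqI:
  assumes "\<And>\<phi>. ext_functional p \<phi> \<Longrightarrow> \<phi> v = \<phi> w"
  shows "ext_class scK scA p v = ext_class scK scA p w"
proof (rule ccontr)
  assume "ext_class scK scA p v \<noteq> ext_class scK scA p w"
  then have "v - w \<notin> rep.span (rels p)"
    by (simp add: ext_class_eq_iff ext_rel_eq_span)
  then obtain \<phi> where "ext_linear \<phi>" "\<forall>v\<in>rels p. \<phi> v = 0" "\<phi> (v - w) \<noteq> 0"
    by (rule rep.functional_separates_span)
  then show False
    using assms[of \<phi>] by (simp add: ext_functional_def ext_linearD)
qed

lemma ext_functional_alternating_form:
  "ext_functional p \<phi> \<Longrightarrow> p \<noteq> 0 \<Longrightarrow> alternating_form scK scA p (\<lambda>xs. \<phi> (tuple xs))"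
  unfolding ext_functional_def using vanish_rels_iff_alternating_form by blast

text \<open>Compatibility with the relations is tested by linear functionals, because the right-hand sides
  of the formulas are additive in \<open>a\<close> only modulo the relations.\<close>

definition descends ::
  "nat \<Rightarrow> nat \<Rightarrow> nat \<Rightarrow> ('a \<times> ('g list \<Rightarrow>\<^sub>0 'k) \<Rightarrow> 'a \<times> ('g list \<Rightarrow>\<^sub>0 'k) \<Rightarrow> 'a \<times> ('g list \<Rightarrow>\<^sub>0 'k)) \<Rightarrow> bool" where
  "descends p q r f \<longleftrightarrow>
     (\<forall>v\<in>ext_reps p. \<forall>w\<in>ext_reps q. f v w \<in> ext_reps r) \<and>
     (\<forall>\<phi>. ext_functional r \<phi> \<longrightarrow>
        (\<forall>w\<in>ext_reps q. ext_linear (\<lambda>v. \<phi> (f v w))) \<and>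
        (\<forall>v\<in>ext_reps p. ext_linear (\<lambda>w. \<phi> (f v w))) \<and>
        (\<forall>v\<in>rels p. \<forall>w\<in>gens q. \<phi> (f v w) = 0) \<and>
        (\<forall>v\<in>gens p. \<forall>w\<in>rels q. \<phi> (f v w) = 0))"

text \<open>Exchanging the arguments up to a scalar reduces the formula for \<open>[a, X]\<close> to
  the one for \<open>[X, a]\<close>.\<close>

lemma descends_flip:
  assumes f: "descends p q r f"
  shows "descends q p r (\<lambda>v w. rep_scale scK c (f w v))"
  unfolding descends_def
proof (intro conjI allI impI)
  show "\<forall>v\<in>ext_reps q. \<forall>w\<in>ext_reps p. rep_scale scK c (f w v) \<in> ext_reps r"
    using f rep.subspace_scale[OF subspace_ext_reps] unfolding descends_def by blast
next
  fix \<phi>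
  assume \<phi>: "ext_functional r \<phi>"
  then have *: "\<phi> (rep_scale scK c v) = c * \<phi> v" for v
    by (intro ext_linearD(3)) (simp add: ext_functional_def)
  have lin: "ext_linear (\<lambda>v. c * \<psi> v)" if "ext_linear \<psi>" for \<psi>
    using that by (simp add: ext_linear_iff algebra_simps)
  show "\<forall>w\<in>ext_reps p. ext_linear (\<lambda>v. \<phi> (rep_scale scK c (f w v)))"
    and "\<forall>v\<in>ext_reps q. ext_linear (\<lambda>w. \<phi> (rep_scale scK c (f w v)))"
    unfolding * using f \<phi> lin unfolding descends_def by blast+
  show "\<forall>v\<in>rels q. \<forall>w\<in>gens p. \<phi> (rep_scale scK c (f w v)) = 0"
    and "\<forall>v\<in>gens q. \<forall>w\<in>rels p. \<phi> (rep_scale scK c (f w v)) = 0"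
    unfolding * mult_eq_0_iff using f \<phi> unfolding descends_def by blast+
qed

text \<open>A relation paired with a generator is killed by assumption. Linearity in the generator
  extends this to all representatives, and linearity in the relation to the span of the relations.
  Then \<open>v\<close> and \<open>w\<close> are replaced one after the other.\<close>

lemma descends_cong:
  assumes f: "descends p q r f"
    and "v \<in> ext_reps p" "v' \<in> ext_reps p" "w \<in> ext_reps q" "w' \<in> ext_reps q"
    and v: "ext_class scK scA p v = ext_class scK scA p v'"
    and w: "ext_class scK scA q w = ext_class scK scA q w'"
  shows "ext_class scK scA r (f v w) = ext_class scK scA r (f v' w')"
proof (rule ext_class_eqI)
  fix \<phi>
  assume \<phi>: "ext_functional r \<phi>"
  have lin: "ext_linear (\<lambda>v. \<phi> (f v w))" if "w \<in> ext_reps q" for w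
    using f \<phi> that unfolding descends_def by blast
  have lin': "ext_linear (\<lambda>w. \<phi> (f v w))" if "v \<in> ext_reps p" for v
    using f \<phi> that unfolding descends_def by blast
  have "\<phi> (f v w) = 0" if "v \<in> rels p" "w \<in> ext_reps q" for v w
    by (rule ext_linear_eq_0_on_span[OF lin', of v "gens q"])
      (use f \<phi> that rels_subset_reps reps_subset_span in \<open>unfold descends_def, blast+\<close>)
  then have left: "\<phi> (f v w) = 0" if "v \<in> ext_rel scK scA p" "w \<in> ext_reps q" for v w
    using that ext_linear_eq_0_on_span[OF lin, of w "rels p"] by (simp add: ext_rel_eq_span)
  have "\<phi> (f v w) = 0" if "w \<in> rels q" "v \<in> ext_reps p" for v w
    by (rule ext_linear_eq_0_on_span[OF lin, of w "gens p"])
      (use f \<phi> that rels_subset_reps reps_subset_span in \<open>unfold descends_def, blast+\<close>)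
  then have right: "\<phi> (f v w) = 0" if "w \<in> ext_rel scK scA q" "v \<in> ext_reps p" for v w
    using that ext_linear_eq_0_on_span[OF lin', of v "rels q"] by (simp add: ext_rel_eq_span)
  have "\<phi> (f v w) = \<phi> (f v' w)"
    using left[of "v - v'" w] v assms(4) ext_linearD(2)[OF lin[OF assms(4)], of v v']
    by (simp add: ext_class_eq_iff)
  also have "\<dots> = \<phi> (f v' w')"
    using right[of "w - w'" v'] w assms(3) ext_linearD(2)[OF lin'[OF assms(3)], of w w']
    by (simp add: ext_class_eq_iff)
  finally show "\<phi> (f v w) = \<phi> (f v' w')" .
qed

section \<open>Bilinear maps on exterior powers\<close>

lemma ext_powerE:
  assumes "X \<in> ext_power scK scA p"
  obtains v where "v \<in> ext_reps p" "X = ext_class scK scA p v"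
  using assms by (auto simp: ext_power_def)

lemma ext_class_in_power [simp]: "v \<in> ext_reps p \<Longrightarrow> ext_class scK scA p v \<in> ext_power scK scA p"
  by (simp add: ext_power_def)

text \<open>Generators span the representatives, so agreement spreads by span induction, first in
  the left argument and then in the right one.\<close>

lemma ext_bilinear_eqI:
  assumes B: "B \<in> ext_bilinear scK scA p q r" and B': "B' \<in> ext_bilinear scK scA p q r"
    and eq: "\<And>v w. v \<in> gens p \<Longrightarrow> w \<in> gens q \<Longrightarrow>
      B (ext_class scK scA p v, ext_class scK scA q w) = B' (ext_class scK scA p v, ext_class scK scA q w)"
  shows "B = B'"
proof -
  let ?p = "ext_class scK scA p" and ?q = "ext_class scK scA q"
  have map: "C (X, Y) \<in> ext_power scK scA r"
    if "C \<in> ext_bilinear scK scA p q r" "X \<in> ext_power scK scA p" "Y \<in> ext_power scK scA q" for C X Y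
    using that by (auto simp: ext_bilinear_def)
  have scale: "C (?p (rep_scale scK c v), ?q w) = ext_scale scK scA r c (C (?p v, ?q w))"
      "C (?p v, ?q (rep_scale scK c w)) = ext_scale scK scA r c (C (?p v, ?q w))"
    if "C \<in> ext_bilinear scK scA p q r" "v \<in> ext_reps p" "w \<in> ext_reps q" for C c v w
    using that by (auto simp: ext_bilinear_def ext_scale_ext_class[symmetric])
  have add: "C (?p (v + v'), ?q w) = C (?p v, ?q w) + C (?p v', ?q w)"
    if "C \<in> ext_bilinear scK scA p q r" "v \<in> ext_reps p" "v' \<in> ext_reps p" "w \<in> ext_reps q" for C v v' w
    using that by (auto simp: ext_bilinear_def ext_class_add[symmetric])
  have add': "C (?p v, ?q (w + w')) = C (?p v, ?q w) + C (?p v, ?q w')"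
    if "C \<in> ext_bilinear scK scA p q r" "v \<in> ext_reps p" "w' \<in> ext_reps q" "w \<in> ext_reps q" for C v w w'
    using that by (auto simp: ext_bilinear_def ext_class_add[symmetric])
  \<comment> \<open>Sets under elementwise addition admit no cancellation, so the value at a zero
    class is obtained by scaling with \<open>0\<close> rather than from additivity.\<close>
  have scale0: "ext_scale scK scA r 0 X = ext_class scK scA r 0" if "X \<in> ext_power scK scA r" for X
    using that by (elim ext_powerE) (simp add: ext_scale_ext_class)
  have zero: "C (?p 0, ?q w) = ext_class scK scA r 0"
    if "C \<in> ext_bilinear scK scA p q r" "w \<in> ext_reps q" for C w
    using scale(1)[OF that(1) _ that(2), of 0 0] that rep.subspace_0[OF subspace_ext_reps]
    by (simp add: scale0 map)
  have zero': "C (?p v, ?q 0) = ext_class scK scA r 0"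
    if "C \<in> ext_bilinear scK scA p q r" "v \<in> ext_reps p" for C v
    using scale(2)[OF that(1) that(2), of 0 0] that rep.subspace_0[OF subspace_ext_reps]
    by (simp add: scale0 map)
  note sub = rep.subspace_0[OF subspace_ext_reps] rep.subspace_add[OF subspace_ext_reps]
    rep.subspace_scale[OF subspace_ext_reps]
  have gp: "v \<in> ext_reps p" if "v \<in> gens p" for v p
    using that gens_subset_reps by blast
  have 1: "B (?p v, ?q w) = B' (?p v, ?q w)" if w: "w \<in> gens q" and v: "v \<in> ext_reps p" for v w
  proof -
    have "v \<in> rep.span (gens p)"
      using v reps_subset_span by blast
    \<comment> \<open>Membership in \<open>ext_reps p\<close> is carried along because additivity
      and homogeneity of the maps are available only for classes of representatives.\<close>
    then have "v \<in> ext_reps p \<and> B (?p v, ?q w) = B' (?p v, ?q w)"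
    proof (induction rule: rep.span_induct_alt)
      case base
      then show ?case
        by (simp add: zero[OF B] zero[OF B'] gp[OF w] sub)
    next
      case (step c x y)
      then show ?case
        using gp[OF w] gp[OF step(1)] eq[OF step(1) w]
        by (simp add: add[OF B] add[OF B'] scale[OF B] scale[OF B'] sub)
    qed
    then show ?thesis ..
  qed
  have 2: "B (?p v, ?q w) = B' (?p v, ?q w)" if w: "w \<in> ext_reps q" and v: "v \<in> ext_reps p" for v w
  proof -
    have "w \<in> rep.span (gens q)"
      using w reps_subset_span by blast
    then have "w \<in> ext_reps q \<and> B (?p v, ?q w) = B' (?p v, ?q w)"
    proof (induction rule: rep.span_induct_alt)
      case base
      then show ?case
        by (simp add: zero'[OF B] zero'[OF B'] v sub)
    next
      case (step c x y)
      then show ?case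
        using v gp[OF step(1)] 1[OF step(1) v]
        by (simp add: add'[OF B] add'[OF B'] scale[OF B] scale[OF B'] sub)
    qed
    then show ?thesis ..
  qed
  \<comment> \<open>Extensional functions are equal once they agree on their domain, which consists
    of pairs of classes of representatives.\<close>
  show ?thesis
  proof (rule PiE_ext)
    show "B \<in> ext_power scK scA p \<times> ext_power scK scA q \<rightarrow>\<^sub>E ext_power scK scA r"
      "B' \<in> ext_power scK scA p \<times> ext_power scK scA q \<rightarrow>\<^sub>E ext_power scK scA r"
      using B B' by (simp_all add: ext_bilinear_def)
    show "B Z = B' Z" if "Z \<in> ext_power scK scA p \<times> ext_power scK scA q" for Z
      using that by (auto elim!: ext_powerE simp: 2)
  qed
qed

text \<open>The map is defined through chosen representatives, and \<open>descends_cong\<close>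
  removes the choice. Sums and multiples are compared after applying functionals, since only the
  composites of \<open>f\<close> with these are known to be linear.\<close>

lemma descends_imp_ext_bilinear:
  assumes f: "descends p q r f"
  shows "\<exists>B \<in> ext_bilinear scK scA p q r. \<forall>v\<in>ext_reps p. \<forall>w\<in>ext_reps q.
    B (ext_class scK scA p v, ext_class scK scA q w) = ext_class scK scA r (f v w)"
proof -
  let ?c = "ext_class scK scA"
  define rep where "rep p X = (SOME v. v \<in> ext_reps p \<and> ?c p v = X)" for p X
  have rep: "rep p (?c p v) \<in> ext_reps p \<and> ?c p (rep p (?c p v)) = ?c p v" if "v \<in> ext_reps p" for p v
    unfolding rep_def by (rule someI[of _ v]) (simp add: that)
  define B where "B = restrict (\<lambda>(X, Y). ?c r (f (rep p X) (rep q Y))) (ext_power scK scA p \<times> ext_power scK scA q)"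
  have B: "B (?c p v, ?c q w) = ?c r (f v w)" if "v \<in> ext_reps p" "w \<in> ext_reps q" for v w
    using that rep[OF that(1)] rep[OF that(2)] descends_cong[OF f, of "rep p (?c p v)" v "rep q (?c q w)" w]
    by (simp add: B_def)
  have reps: "f v w \<in> ext_reps r" if "v \<in> ext_reps p" "w \<in> ext_reps q" for v w
    using f that unfolding descends_def by blast
  have add: "?c r (f (v + v') w) = ?c r (f v w) + ?c r (f v' w)"
    and scale: "?c r (f (rep_scale scK c v) w) = ext_scale scK scA r c (?c r (f v w))"
    if "w \<in> ext_reps q" for v v' w c
  proof -
    have *: "ext_linear \<phi>" "ext_linear (\<lambda>v. \<phi> (f v w))" if "ext_functional r \<phi>" for \<phi>
      using f that \<open>w \<in> ext_reps q\<close> unfolding descends_def ext_functional_def by blast+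
    show "?c r (f (v + v') w) = ?c r (f v w) + ?c r (f v' w)"
      unfolding ext_class_add
      by (rule ext_class_eqI) (simp only: ext_linearD(1)[OF *(1)] ext_linearD(1)[OF *(2)])
    show "?c r (f (rep_scale scK c v) w) = ext_scale scK scA r c (?c r (f v w))"
      unfolding ext_scale_ext_class
      by (rule ext_class_eqI) (simp only: ext_linearD(3)[OF *(1)] ext_linearD(3)[OF *(2)])
  qed
  have add': "?c r (f v (w + w')) = ?c r (f v w) + ?c r (f v w')"
    and scale': "?c r (f v (rep_scale scK c w)) = ext_scale scK scA r c (?c r (f v w))"
    if "v \<in> ext_reps p" for v w w' c
  proof -
    have *: "ext_linear \<phi>" "ext_linear (\<lambda>w. \<phi> (f v w))" if "ext_functional r \<phi>" for \<phi>
      using f that \<open>v \<in> ext_reps p\<close> unfolding descends_def ext_functional_def by blast+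
    show "?c r (f v (w + w')) = ?c r (f v w) + ?c r (f v w')"
      unfolding ext_class_add
      by (rule ext_class_eqI) (simp only: ext_linearD(1)[OF *(1)] ext_linearD(1)[OF *(2)])
    show "?c r (f v (rep_scale scK c w)) = ext_scale scK scA r c (?c r (f v w))"
      unfolding ext_scale_ext_class
      by (rule ext_class_eqI) (simp only: ext_linearD(3)[OF *(1)] ext_linearD(3)[OF *(2)])
  qed
  note sub = rep.subspace_add[OF subspace_ext_reps] rep.subspace_scale[OF subspace_ext_reps]
  have "B \<in> ext_power scK scA p \<times> ext_power scK scA q \<rightarrow>\<^sub>E ext_power scK scA r"
  proof (rule PiE_I)
    show "B Z \<in> ext_power scK scA r" if "Z \<in> ext_power scK scA p \<times> ext_power scK scA q" for Z
      using that by (auto elim!: ext_powerE simp: B reps)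
  qed (simp add: B_def)
  moreover have "B (X + X', Y) = B (X, Y) + B (X', Y)"
    if "X \<in> ext_power scK scA p" "X' \<in> ext_power scK scA p" "Y \<in> ext_power scK scA q" for X X' Y
    using that
    by (elim ext_powerE) (simp only: ext_class_add B sub add)
  moreover have "B (X, Y + Y') = B (X, Y) + B (X, Y')"
    if "X \<in> ext_power scK scA p" "Y' \<in> ext_power scK scA q" "Y \<in> ext_power scK scA q" for X Y Y'
    using that
    by (elim ext_powerE) (simp only: ext_class_add B sub add')
  moreover have "B (ext_scale scK scA p c X, Y) = ext_scale scK scA r c (B (X, Y))"
    if "X \<in> ext_power scK scA p" "Y \<in> ext_power scK scA q" for c X Y
    using that
    by (elim ext_powerE) (simp only: ext_scale_ext_class B sub scale)
  moreover have "B (X, ext_scale scK scA q c Y) = ext_scale scK scA r c (B (X, Y))"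
    if "X \<in> ext_power scK scA p" "Y \<in> ext_power scK scA q" for c X Y
    using that
    by (elim ext_powerE) (simp only: ext_scale_ext_class B sub scale')
  ultimately have "B \<in> ext_bilinear scK scA p q r"
    by (simp add: ext_bilinear_def)
  with B show ?thesis
    by blast
qed

lemma descends_imp_ex1_ext_bilinear:
  assumes f: "descends p q r f"
  shows "\<exists>!B. B \<in> ext_bilinear scK scA p q r \<and> (\<forall>v\<in>gens p. \<forall>w\<in>gens q.
    B (ext_class scK scA p v, ext_class scK scA q w) = ext_class scK scA r (f v w))"
proof -
  let ?P = "\<lambda>B. B \<in> ext_bilinear scK scA p q r \<and> (\<forall>v\<in>gens p. \<forall>w\<in>gens q.
    B (ext_class scK scA p v, ext_class scK scA q w) = ext_class scK scA r (f v w))"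
  have "\<exists>B. ?P B"
    using descends_imp_ext_bilinear[OF f] gens_subset_reps[of p] gens_subset_reps[of q] by blast
  moreover have "B = B'" if "?P B" "?P B'" for B B'
    by (rule ext_bilinear_eqI[of _ p q r]) (use that in simp_all)
  ultimately show ?thesis
    by blast
qed

end

section \<open>The Schouten--Nijenhuis bracket\<close>

context lie_rinehart
begin

text \<open>Only the second component of \<open>w\<close> is read: in positive degree, where the
  extension is used, the first one is \<open>0\<close>.\<close>

definition lin_ext ::
  "('g list \<Rightarrow> 'a \<times> ('g list \<Rightarrow>\<^sub>0 'k)) \<Rightarrow> 'a \<times> ('g list \<Rightarrow>\<^sub>0 'k) \<Rightarrow> 'a \<times> ('g list \<Rightarrow>\<^sub>0 'k)" where
  "lin_ext h w = (\<Sum>xs\<in>Poly_Mapping.keys (snd w). rep_scale scK (Poly_Mapping.lookup (snd w) xs) (h xs))"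

lemma lin_ext_superset:
  "finite S \<Longrightarrow> Poly_Mapping.keys (snd w) \<subseteq> S \<Longrightarrow>
    lin_ext h w = (\<Sum>xs\<in>S. rep_scale scK (Poly_Mapping.lookup (snd w) xs) (h xs))"
  unfolding lin_ext_def by (intro sum.mono_neutral_left) (auto simp: in_keys_iff)

lemma lin_ext_add: "lin_ext h (v + w) = lin_ext h v + lin_ext h w"
proof -
  let ?S = "Poly_Mapping.keys (snd v) \<union> Poly_Mapping.keys (snd w)"
  have "lin_ext h u = (\<Sum>xs\<in>?S. rep_scale scK (Poly_Mapping.lookup (snd u) xs) (h xs))"
    if "u = v \<or> u = w \<or> u = v + w" for u
    using that Poly_Mapping.keys_add[of "snd v" "snd w"] by (intro lin_ext_superset) auto
  then show ?thesis
    by (simp add: lookup_add rep.scale_left_distrib sum.distrib)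
qed

lemma lin_ext_scale: "lin_ext h (rep_scale scK c w) = rep_scale scK c (lin_ext h w)"
proof -
  have "lin_ext h (rep_scale scK c w)
      = (\<Sum>xs\<in>Poly_Mapping.keys (snd w). rep_scale scK (Poly_Mapping.lookup (snd (rep_scale scK c w)) xs) (h xs))"
    by (intro lin_ext_superset) (auto simp: rep_scale_def in_keys_iff)
  then show ?thesis
    by (simp add: lin_ext_def rep.scale_sum_right) (simp add: rep_scale_def)
qed

lemma lin_ext_tuple [simp]: "lin_ext h (tuple xs) = h xs"
  by (simp add: lin_ext_def tuple_def)

lemma lin_ext_in_reps:
  assumes "p \<noteq> 0" "w \<in> ext_reps p" "\<And>xs. length xs = p \<Longrightarrow> h xs \<in> ext_reps r"
  shows "lin_ext h w \<in> ext_reps r"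
  unfolding lin_ext_def
  using assms
  by (intro rep.subspace_sum[OF subspace_ext_reps] rep.subspace_scale[OF subspace_ext_reps])
    (auto simp: ext_reps_def)

lemma ext_linear_lin_ext: "ext_linear \<phi> \<Longrightarrow> ext_linear (\<lambda>w. \<phi> (lin_ext h w))"
  unfolding ext_linear_iff lin_ext_add lin_ext_scale by blast

text \<open>Compatibility with the relations in the first argument becomes an alternating condition
  on tuples, by \<open>vanish_rels_iff_alternating_form\<close>. For relations in the second
  argument it suffices to insert single tuples in the first, since these are the generators.\<close>

lemma descends_lin_ext:
  assumes "p \<noteq> 0"
    and reps: "\<And>xs w. length xs = p \<Longrightarrow> w \<in> ext_reps q \<Longrightarrow> g xs w \<in> ext_reps r"
    and lin: "\<And>\<phi> xs. ext_functional r \<phi> \<Longrightarrow> length xs = p \<Longrightarrow> ext_linear (\<lambda>w. \<phi> (g xs w))"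
    and alt: "\<And>\<phi> w. ext_functional r \<phi> \<Longrightarrow> w \<in> gens q \<Longrightarrow> alternating_form scK scA p (\<lambda>xs. \<phi> (g xs w))"
    and zero: "\<And>\<phi> xs w. ext_functional r \<phi> \<Longrightarrow> length xs = p \<Longrightarrow> w \<in> rels q \<Longrightarrow> \<phi> (g xs w) = 0"
  shows "descends p q r (\<lambda>v w. lin_ext (\<lambda>xs. g xs w) v)"
  unfolding descends_def
proof (intro conjI ballI allI impI)
  show "lin_ext (\<lambda>xs. g xs w) v \<in> ext_reps r" if "v \<in> ext_reps p" "w \<in> ext_reps q" for v w
    using assms(1) that reps by (intro lin_ext_in_reps)
next
  fix \<phi>
  assume \<phi>: "ext_functional r \<phi>"
  then have \<phi>': "ext_linear \<phi>"
    by (simp add: ext_functional_def)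
  show lin_left: "ext_linear (\<lambda>v. \<phi> (lin_ext (\<lambda>xs. g xs w) v))" for w
    by (rule ext_linear_lin_ext[OF \<phi>'])
  show "ext_linear (\<lambda>w. \<phi> (lin_ext (\<lambda>xs. g xs w) v))" if "v \<in> ext_reps p" for v
  proof -
    have "ext_linear (\<lambda>w. \<phi> (g xs w))" if "xs \<in> Poly_Mapping.keys (snd v)" for xs
      using \<open>v \<in> ext_reps p\<close> that \<open>p \<noteq> 0\<close> by (intro lin[OF \<phi>]) (auto simp: ext_reps_def)
    then show ?thesis
      unfolding lin_ext_def ext_linear_iff
      by (simp add: ext_linearD[OF \<phi>'] sum.distrib[symmetric] sum_distrib_left algebra_simps)
  qed
  show "\<phi> (lin_ext (\<lambda>xs. g xs w) v) = 0" if "v \<in> rels p" "w \<in> gens q" for v w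
    using vanish_rels_iff_alternating_form[OF lin_left[of w] \<open>p \<noteq> 0\<close>] alt[OF \<phi> that(2)] that(1) by simp
  show "\<phi> (lin_ext (\<lambda>xs. g xs w) v) = 0" if v: "v \<in> gens p" and w: "w \<in> rels q" for v w
  proof -
    obtain xs where "v = tuple xs" "length xs = p"
      using v \<open>p \<noteq> 0\<close> by (auto simp: gens_def)
    then show ?thesis
      using zero[OF \<phi> _ w, of xs] by simp
  qed
qed

lemma tuple_in_reps: "length xs = p \<Longrightarrow> p \<noteq> 0 \<Longrightarrow> tuple xs \<in> ext_reps p"
  by (auto simp: ext_reps_def tuple_def)

section \<open>Calculus with the bracket and the anchor\<close>

lemma bracket_add: "br (x + x') y = br x y + br x' y" "br x (y + y') = br x y + br x y'"
  and bracket_scale: "br (scA (scK c 1) x) y = scA (scK c 1) (br x y)"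
    "br x (scA (scK c 1) y) = scA (scK c 1) (br x y)"
  using G.bracket_linear_left[of y] G.bracket_linear_right[of x] by (simp_all add: Vector_Spaces.linear_iff)

lemma bracket_antisym: "br x y = - br y x"
proof -
  have "br (x + y) (x + y) = br x y + br y x"
    unfolding bracket_add by (simp add: G.bracket_self)
  then show ?thesis
    by (simp add: G.bracket_self eq_neg_iff_add_eq_0)
qed

lemma scA_zero: "scA 0 x = 0" "scA a 0 = 0"
  using scA_left_distrib[of 0 0 x] scA_right_distrib[of a 0 0] by simp_all

lemma scA_minus: "scA (- a) x = - scA a x" "scA a (- x) = - scA a x"
proof -
  show "scA (- a) x = - scA a x" "scA a (- x) = - scA a x"
    using scA_left_distrib[of "- a" a x] scA_right_distrib[of a "- x" x]
    by (simp_all add: eq_neg_iff_add_eq_0 scA_zero)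
qed

text \<open>Antisymmetry transfers the Leibniz rule to the left argument and reverses the sign of
  the anchor term.\<close>

lemma bracket_leibniz_left: "br (scA a x) y = scA a (br x y) + scA (- rho y a) x"
  using bracket_antisym[of "scA a x" y] bracket_antisym[of x y]
  by (simp add: bracket_leibniz scA_minus)

lemma rho_linear: "rho x (a + b) = rho x a + rho x b" "rho x (scK c a) = scK c (rho x a)"
  using rho_Der[of x] by (simp_all add: Der_def Vector_Spaces.linear_iff)

text \<open>The product rule for \<open>1 * 1\<close> gives \<open>rho x 1 = 0\<close>. Hence the
  anchor term of the Leibniz rule disappears for constants.\<close>

lemma rho_const: "rho x (scK c 1) = 0"
proof -
  have "rho x (1 * 1) = 1 * rho x 1 + rho x 1 * 1"
    using rho_Der[of x] unfolding Der_def by blast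
  then show ?thesis
    by (simp add: rho_linear)
qed

lemma scK_one_mult: "scK c 1 * b = scK c b"
  using A.scale_mult_left[of c 1 b] by simp

section \<open>The bracket of two elements of positive degree\<close>

lemma sum_positions: "(\<Sum>i = 1..Suc n. f i) = (\<Sum>i\<le>n. f (Suc i))"
  by (simp only: One_nat_def sum.atLeast1_atMost_eq lessThan_Suc_atMost)

text \<open>Positions are now counted from \<open>0\<close>; both indices drop by one, so the parity
  of \<open>i + j\<close> is unchanged.\<close>

lemma SN_rhs_eq:
  assumes "length xs = Suc n" "length ys = Suc m"
  shows "SN_rhs scK br xs ys = (\<Sum>i\<le>n. \<Sum>j\<le>m.
    rep_scale scK ((-1) ^ (i + j)) (tuple (br (xs ! i) (ys ! j) # omit (Suc i) xs @ omit (Suc j) ys)))"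
  unfolding SN_rhs_def assms sum_positions by (simp add: entry_def)

lemma SN_rhs_in_reps:
  assumes "length xs = Suc n" "length ys = Suc m"
  shows "SN_rhs scK br xs ys \<in> ext_reps (Suc (n + m))"
  unfolding SN_rhs_eq[OF assms]
  using assms
  by (intro rep.subspace_sum[OF subspace_ext_reps] rep.subspace_scale[OF subspace_ext_reps] tuple_in_reps)
    auto

text \<open>For fixed \<open>j\<close> the sum over \<open>i\<close> is an instance of
  \<open>alternating_form_derivation\<close> with \<open>D = [_, y_j]\<close>, nothing in front and
  the remaining \<open>ys\<close> behind; for fixed \<open>i\<close> the sum over \<open>j\<close>
  is one with \<open>D = [x_i, _]\<close> and the remaining \<open>xs\<close> in front. The empty
  lists in the formulas stand for the missing \<open>us\<close> and \<open>vs\<close>.\<close>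

lemma
  assumes \<phi>: "ext_functional (Suc (n + m)) \<phi>"
  shows SN_rhs_alternating_left:
      "length ys = Suc m \<Longrightarrow> alternating_form scK scA (Suc n) (\<lambda>xs. \<phi> (SN_rhs scK br xs ys))"
    and SN_rhs_alternating_right:
      "length xs = Suc n \<Longrightarrow> alternating_form scK scA (Suc m) (\<lambda>ys. \<phi> (SN_rhs scK br xs ys))"
proof -
  let ?t = "\<lambda>xs. \<phi> (tuple xs)"
  have t: "alternating_form scK scA (Suc (n + m)) ?t"
    using ext_functional_alternating_form[OF \<phi>] by simp
  have lin: "ext_linear \<phi>"
    using \<phi> by (simp add: ext_functional_def)
  show "alternating_form scK scA (Suc n) (\<lambda>xs. \<phi> (SN_rhs scK br xs ys))" if ys: "length ys = Suc m"
  proof (rule alternating_form_cong)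
    show "alternating_form scK scA (Suc n) (\<lambda>xs. \<Sum>j\<le>m. (-1) ^ j *
        (\<Sum>i\<le>n. (-1) ^ i * ?t (br (xs ! i) (ys ! j) # [] @ omit (Suc i) xs @ omit (Suc j) ys)))"
    proof (rule alternating_form_sum, rule alternating_form_mult)
      fix j
      assume "j \<in> {..m}"
      then show "alternating_form scK scA (Suc n)
          (\<lambda>xs. \<Sum>i\<le>n. (-1) ^ i * ?t (br (xs ! i) (ys ! j) # [] @ omit (Suc i) xs @ omit (Suc j) ys))"
        using t ys
        by (intro alternating_form_derivation[where D = "\<lambda>x. br x (ys ! j)" and d = "\<lambda>a. - rho (ys ! j) a"])
          (simp_all add: bracket_add bracket_scale bracket_leibniz_left rho_const scA_zero)
    qed
    fix xs :: "'g list"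
    assume xs: "length xs = Suc n"
    let ?b = "\<lambda>i j. ?t (br (xs ! i) (ys ! j) # omit (Suc i) xs @ omit (Suc j) ys)"
    have "\<phi> (SN_rhs scK br xs ys) = (\<Sum>i\<le>n. \<Sum>j\<le>m. (-1) ^ (i + j) * ?b i j)"
      by (simp add: SN_rhs_eq[OF xs ys] ext_linearD[OF lin])
    also have "\<dots> = (\<Sum>j\<le>m. \<Sum>i\<le>n. (-1) ^ (i + j) * ?b i j)"
      by (rule sum.swap)
    also have "\<dots> = (\<Sum>j\<le>m. (-1) ^ j * (\<Sum>i\<le>n. (-1) ^ i * ?b i j))"
      by (simp add: sum_distrib_left power_add mult_ac)
    finally show "(\<Sum>j\<le>m. (-1) ^ j *
        (\<Sum>i\<le>n. (-1) ^ i * ?t (br (xs ! i) (ys ! j) # [] @ omit (Suc i) xs @ omit (Suc j) ys)))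
      = \<phi> (SN_rhs scK br xs ys)"
      by simp
  qed
  show "alternating_form scK scA (Suc m) (\<lambda>ys. \<phi> (SN_rhs scK br xs ys))" if xs: "length xs = Suc n"
  proof (rule alternating_form_cong)
    show "alternating_form scK scA (Suc m) (\<lambda>ys. \<Sum>i\<le>n. (-1) ^ i *
        (\<Sum>j\<le>m. (-1) ^ j * ?t (br (xs ! i) (ys ! j) # omit (Suc i) xs @ omit (Suc j) ys @ [])))"
    proof (rule alternating_form_sum, rule alternating_form_mult)
      fix i
      assume "i \<in> {..n}"
      then show "alternating_form scK scA (Suc m)
          (\<lambda>ys. \<Sum>j\<le>m. (-1) ^ j * ?t (br (xs ! i) (ys ! j) # omit (Suc i) xs @ omit (Suc j) ys @ []))"
        using t xs
        by (intro alternating_form_derivation[where D = "br (xs ! i)" and d = "rho (xs ! i)"])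
          (simp_all add: bracket_add bracket_scale bracket_leibniz rho_const scA_zero)
    qed
    show "(\<Sum>i\<le>n. (-1) ^ i *
        (\<Sum>j\<le>m. (-1) ^ j * ?t (br (xs ! i) (ys ! j) # omit (Suc i) xs @ omit (Suc j) ys @ [])))
      = \<phi> (SN_rhs scK br xs ys)" if "length ys = Suc m" for ys
      unfolding SN_rhs_eq[OF xs that]
      by (simp add: ext_linearD[OF lin] sum_distrib_left power_add mult_ac)
  qed
qed

lemma descends_SN_rhs:
  "descends (Suc n) (Suc m) (Suc (n + m)) (\<lambda>v w. lin_ext (\<lambda>xs. lin_ext (SN_rhs scK br xs) w) v)"
proof (rule descends_lin_ext)
  fix \<phi> and xs :: "'g list"
  assume \<phi>: "ext_functional (Suc (n + m)) \<phi>" and xs: "length xs = Suc n"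
  show lin: "ext_linear (\<lambda>w. \<phi> (lin_ext (SN_rhs scK br xs) w))"
    using \<phi> by (intro ext_linear_lin_ext) (simp add: ext_functional_def)
  \<comment> \<open>For fixed \<open>xs\<close> the composite of \<phi> with the inner extension is
    itself a linear functional, and it kills the relations of degree \<open>Suc m\<close> because it
    is alternating in \<open>ys\<close>.\<close>
  show "\<phi> (lin_ext (SN_rhs scK br xs) w) = 0" if "w \<in> rels (Suc m)" for w
    using vanish_rels_iff_alternating_form[OF lin, of "Suc m"] SN_rhs_alternating_right[OF \<phi> xs] that by simp
next
  fix \<phi> w
  assume "ext_functional (Suc (n + m)) \<phi>" "w \<in> gens (Suc m)"
  then show "alternating_form scK scA (Suc n) (\<lambda>xs. \<phi> (lin_ext (SN_rhs scK br xs) w))"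
    by (auto simp: gens_def SN_rhs_alternating_left)
qed (auto intro!: lin_ext_in_reps SN_rhs_in_reps)

section \<open>The bracket with an element of \<open>A\<close>\<close>

lemma scaled_tuple_in_reps: "scaled_tuple scA b zs \<in> ext_reps (length zs)"
  by (cases zs) (auto simp: scaled_tuple_def ext_reps_def scalar_def tuple_def)

lemma scaled_tuple_Cons: "zs \<noteq> [] \<Longrightarrow> scaled_tuple scA b zs = tuple (zs[0 := scA b (zs ! 0)])"
  by (cases zs) (simp_all add: scaled_tuple_def)

text \<open>In degree \<open>0\<close> the representative is the scalar itself and linearity is
  immediate. Otherwise the coefficient acts on the first entry, and balancing lets a factor of it
  act on any entry \<open>m\<close> instead.\<close>

lemma ext_functional_scaled_tuple:
  assumes \<phi>: "ext_functional n \<phi>" and zs: "length zs = n"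
  shows "\<phi> (scaled_tuple scA (b + c) zs) = \<phi> (scaled_tuple scA b zs) + \<phi> (scaled_tuple scA c zs)"
    and "\<phi> (scaled_tuple scA (scK k b) zs) = k * \<phi> (scaled_tuple scA b zs)"
    and "m < n \<Longrightarrow> \<phi> (scaled_tuple scA (c * b) zs) = \<phi> (scaled_tuple scA b (zs[m := scA c (zs ! m)]))"
proof -
  have lin: "ext_linear \<phi>"
    using \<phi> by (simp add: ext_functional_def)
  consider (0) "zs = []" | (Suc) "zs \<noteq> []" "0 < n" "alternating_form scK scA n (\<lambda>xs. \<phi> (tuple xs))"
    using zs ext_functional_alternating_form[OF \<phi>] by fastforce
  note cases = this
  show "\<phi> (scaled_tuple scA (b + c) zs) = \<phi> (scaled_tuple scA b zs) + \<phi> (scaled_tuple scA c zs)"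
  proof (cases rule: cases)
    case 0
    then show ?thesis
      by (simp add: scaled_tuple_def scalar_def flip: ext_linearD(1)[OF lin])
  next
    case Suc
    then show ?thesis
      using zs by (simp add: scaled_tuple_Cons scA_left_distrib alternating_form_add[OF Suc(3)])
  qed
  show "\<phi> (scaled_tuple scA (scK k b) zs) = k * \<phi> (scaled_tuple scA b zs)"
  proof (cases rule: cases)
    case 0
    have "scalar (scK k b) = rep_scale scK k (scalar b :: 'a \<times> ('g list \<Rightarrow>\<^sub>0 'k))"
      by (simp add: scalar_def rep_scale_def)
    then show ?thesis
      using 0 by (simp add: scaled_tuple_def ext_linearD[OF lin])
  next
    case Suc
    then show ?thesis
      using zs by (simp add: scaled_tuple_Cons alternating_form_scale[OF Suc(3)] flip: scK_one_mult[of k b] scA_scA)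
  qed
  show "\<phi> (scaled_tuple scA (c * b) zs) = \<phi> (scaled_tuple scA b (zs[m := scA c (zs ! m)]))" if "m < n"
  proof (cases rule: cases)
    case 0
    then show ?thesis
      using that zs by simp
  next
    case Suc
    let ?z = "zs[0 := scA b (zs ! 0)]"
    have "\<phi> (tuple (?z[0 := scA c (?z ! 0)])) = \<phi> (tuple (?z[m := scA c (?z ! m)]))"
      using zs that by (intro alternating_form_balanced[OF Suc(3)]) auto
    then show ?thesis
      using zs Suc that
      by (cases "m = 0") (simp_all add: scaled_tuple_Cons scA_scA mult.commute list_update_swap[of m 0])
  qed
qed

text \<open>In positive degree this is \<open>alternating_form_act\<close> at the first entry; in
  degree \<open>0\<close> the conditions are empty.\<close>

lemma alternating_form_scaled_tuple:
  assumes "ext_functional n \<phi>"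
  shows "alternating_form scK scA n (\<lambda>zs. \<phi> (scaled_tuple scA b zs))"
proof (cases "n = 0")
  case True
  then show ?thesis
    by (simp add: alternating_form_def)
next
  case False
  have "alternating_form scK scA n (\<lambda>zs. \<phi> (tuple (zs[0 := scA b (zs ! 0)])))"
    using False ext_functional_alternating_form[OF assms]
    by (intro alternating_form_act) (simp_all add: scA_right_distrib scA_scA mult.commute)
  then show ?thesis
    by (rule alternating_form_cong) (use False in \<open>auto simp: scaled_tuple_Cons\<close>)
qed

lemma SN_rhs_right_eq:
  assumes "length xs = Suc n"
  shows "SN_rhs_right scK scA rho xs a = (\<Sum>i\<le>n.
    rep_scale scK ((-1) ^ (n - i)) (scaled_tuple scA (rho (xs ! i) a) (omit (Suc i) xs)))"
  unfolding SN_rhs_right_def assms sum_positions by (simp add: entry_def)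

text \<open>With \<open>p = length xs\<close>, the exponents \<open>p + (p - i)\<close> and
  \<open>i\<close> have the same parity, so the two brackets differ only by the global sign
  \<open>(-1) ^ p\<close>.\<close>

lemma SN_rhs_left_eq:
  "SN_rhs_left scK scA rho a xs = rep_scale scK ((-1) ^ length xs) (SN_rhs_right scK scA rho xs a)"
proof -
  have "(-1 :: 'k) ^ length xs * (-1) ^ (length xs - i) = (-1) ^ i" if "i \<le> length xs" for i
  proof -
    have "length xs + (length xs - i) = i + 2 * (length xs - i)"
      using that by simp
    then show ?thesis
      by (metis power_add power_minus1_even mult.right_neutral)
  qed
  then show ?thesis
    by (simp add: SN_rhs_left_def SN_rhs_right_def rep.scale_sum_right)
qed

lemma SN_rhs_right_in_reps:
  assumes "length xs = Suc n"
  shows "SN_rhs_right scK scA rho xs a \<in> ext_reps n"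
proof -
  have "scaled_tuple scA b (omit (Suc i) xs) \<in> ext_reps n" if "i \<le> n" for i b
    using scaled_tuple_in_reps[of b "omit (Suc i) xs"] assms that by simp
  then show ?thesis
    unfolding SN_rhs_right_eq[OF assms]
    by (intro rep.subspace_sum[OF subspace_ext_reps] rep.subspace_scale[OF subspace_ext_reps]) simp
qed

text \<open>The anchor is linear over \<open>A\<close>, so a factor on the contracted entry becomes
  a coefficient, which may act on any remaining entry: the contraction lemma applies with defect
  \<open>N = 0\<close>. The sign \<open>(-1) ^ (n - i)\<close> differs from \<open>(-1) ^ i\<close>
  by the constant \<open>(-1) ^ n\<close>.\<close>

lemma SN_rhs_right_alternating:
  assumes \<phi>: "ext_functional n \<phi>"
  shows "alternating_form scK scA (Suc n) (\<lambda>xs. \<phi> (SN_rhs_right scK scA rho xs a))"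
proof (rule alternating_form_cong)
  have lin: "ext_linear \<phi>"
    using \<phi> by (simp add: ext_functional_def)
  show "alternating_form scK scA (Suc n) (\<lambda>xs. (-1) ^ n *
      (\<Sum>i\<le>n. (-1) ^ i * \<phi> (scaled_tuple scA (rho (xs ! i) a) (omit (Suc i) xs))))"
    by (intro alternating_form_mult
          alternating_form_contraction[where N = "\<lambda>_ _ _. 0" and E = "\<lambda>x zs. \<phi> (scaled_tuple scA (rho x a) zs)"])
      (simp_all add: alternating_form_scaled_tuple[OF \<phi>] rho_add rho_scale scK_one_mult ext_functional_scaled_tuple[OF \<phi>])
  have sign: "(-1 :: 'k) ^ (n - i) = (-1) ^ n * (-1) ^ i" if "i \<le> n" for i
  proof -
    have "n + i = (n - i) + 2 * i"
      using that by simp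
    then show ?thesis
      by (metis power_add power_minus1_even mult.right_neutral)
  qed
  show "(-1) ^ n * (\<Sum>i\<le>n. (-1) ^ i * \<phi> (scaled_tuple scA (rho (xs ! i) a) (omit (Suc i) xs)))
      = \<phi> (SN_rhs_right scK scA rho xs a)" if "length xs = Suc n" for xs
    unfolding SN_rhs_right_eq[OF that]
    by (simp add: ext_linearD[OF lin] sum_distrib_left sign mult.assoc)
qed

text \<open>The second argument is a scalar, read off by \<open>fst\<close>, and degree
  \<open>0\<close> has no relations; so in \<open>a\<close> only linearity has to be tested. It
  follows from linearity of derivations and of functionals in the coefficient.\<close>

lemma descends_SN_rhs_right:
  "descends (Suc n) 0 n (\<lambda>v w. lin_ext (\<lambda>xs. SN_rhs_right scK scA rho xs (fst w)) v)"
proof (rule descends_lin_ext)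
  fix \<phi> and xs :: "'g list"
  assume \<phi>: "ext_functional n \<phi>" and xs: "length xs = Suc n"
  then have lin: "ext_linear \<phi>"
    by (simp add: ext_functional_def)
  show "ext_linear (\<lambda>w. \<phi> (SN_rhs_right scK scA rho xs (fst w)))"
    unfolding ext_linear_iff SN_rhs_right_eq[OF xs] using xs
    by (simp add: ext_linearD[OF lin] rho_linear rep_scale_def[of _ _ "(_, _)"] rep_scale_def[THEN arg_cong[of _ _ fst]]
        ext_functional_scaled_tuple[OF \<phi>] sum.distrib[symmetric] sum_distrib_left algebra_simps)
qed (auto simp: rels_def intro: SN_rhs_right_in_reps SN_rhs_right_alternating)

end

section \<open>Existence and uniqueness of the three induced bilinear maps\<close>

theorem proposition3p4:
  fixes scK :: "'k::field_char_0 \<Rightarrow> 'a::{comm_ring, comm_monoid_mult} \<Rightarrow> 'a"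
    and scA :: "'a \<Rightarrow> 'g::ab_group_add \<Rightarrow> 'g"
    and br :: "'g \<Rightarrow> 'g \<Rightarrow> 'g"
    and rho :: "'g \<Rightarrow> 'a \<Rightarrow> 'a"
  assumes "lie_rinehart scK scA br rho"
  shows "(\<forall>p\<ge>1. \<forall>q\<ge>1. \<exists>!B. B \<in> ext_bilinear scK scA p q (p + q - 1) \<and>
            (\<forall>xs ys. length xs = p \<longrightarrow> length ys = q \<longrightarrow>
               B (ext_class scK scA p (tuple xs), ext_class scK scA q (tuple ys))
                 = ext_class scK scA (p + q - 1) (SN_rhs scK br xs ys)))
       \<and> (\<forall>p\<ge>1. \<exists>!B. B \<in> ext_bilinear scK scA p 0 (p - 1) \<and>
            (\<forall>xs a. length xs = p \<longrightarrow>
               B (ext_class scK scA p (tuple xs), ext_class scK scA 0 (scalar a))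
                 = ext_class scK scA (p - 1) (SN_rhs_right scK scA rho xs a)))
       \<and> (\<forall>p\<ge>1. \<exists>!B. B \<in> ext_bilinear scK scA 0 p (p - 1) \<and>
            (\<forall>a xs. length xs = p \<longrightarrow>
               B (ext_class scK scA 0 (scalar a), ext_class scK scA p (tuple xs))
                 = ext_class scK scA (p - 1) (SN_rhs_left scK scA rho a xs)))"
proof (intro conjI allI impI)
  interpret lie_rinehart scK scA br rho
    by fact
  have ball_tuple: "(\<forall>v\<in>gens (Suc n). P v) \<longleftrightarrow> (\<forall>xs. length xs = Suc n \<longrightarrow> P (tuple xs))" for n P
    by (auto simp: gens_def)
  have ball_scalar: "(\<forall>v\<in>gens 0. P v) \<longleftrightarrow> (\<forall>a. P (scalar a))" for P
    by (simp add: gens_def)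
  have fst_scalar: "fst (scalar a) = a" for a :: 'a
    by (simp add: scalar_def)
  fix p :: nat
  assume "p \<ge> 1"
  then obtain n where p: "p = Suc n"
    by (cases p) auto
  show "\<exists>!B. B \<in> ext_bilinear scK scA p q (p + q - 1) \<and>
            (\<forall>xs ys. length xs = p \<longrightarrow> length ys = q \<longrightarrow>
               B (ext_class scK scA p (tuple xs), ext_class scK scA q (tuple ys))
                 = ext_class scK scA (p + q - 1) (SN_rhs scK br xs ys))" if q1: "q \<ge> 1" for q
  proof -
    obtain m where q: "q = Suc m"
      using q1 by (cases q) auto
    show ?thesis
      using descends_imp_ex1_ext_bilinear[OF descends_SN_rhs[of n m]] unfolding ball_tuple p q by simp
  qed
  show "\<exists>!B. B \<in> ext_bilinear scK scA p 0 (p - 1) \<and>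
            (\<forall>xs a. length xs = p \<longrightarrow>
               B (ext_class scK scA p (tuple xs), ext_class scK scA 0 (scalar a))
                 = ext_class scK scA (p - 1) (SN_rhs_right scK scA rho xs a))"
    using descends_imp_ex1_ext_bilinear[OF descends_SN_rhs_right[of n]]
    unfolding ball_tuple ball_scalar p by (simp add: fst_scalar)
  \<comment> \<open>The scalar in \<open>descends_flip\<close> is the global sign of
    \<open>SN_rhs_left_eq\<close>, with \<open>p = Suc n\<close>.\<close>
  show "\<exists>!B. B \<in> ext_bilinear scK scA 0 p (p - 1) \<and>
            (\<forall>a xs. length xs = p \<longrightarrow>
               B (ext_class scK scA 0 (scalar a), ext_class scK scA p (tuple xs))
                 = ext_class scK scA (p - 1) (SN_rhs_left scK scA rho a xs))"
    using descends_imp_ex1_ext_bilinear[OF descends_flip[OF descends_SN_rhs_right[of n], of "(-1) ^ Suc n"]]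
    unfolding ball_tuple ball_scalar p by (simp add: fst_scalar SN_rhs_left_eq)
qed

end
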